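(* For all $n\in\mathbb{N}$, $\mathcal{C}(\mathfrak{h}_{2n+1})=\mathfrak{t}(\mathfrak{h}_{2n+1})_{srn}$, where $\mathfrak{h}_{2n+1}$ is the $(2n+1)$-dimensional Heisenberg Lie algebra with basis $\{e_1,\ldots,e_{2n+1}\}$ and nonzero Lie brackets $\mu(e_{2i-1},e_{2i})=e_{2n+1}$, $i=1,\ldots,n$.
   Context: Let $\mathfrak{n}$ be a real nilpotent Lie algebra of dimension $N$ with Lie bracket $[\cdot,\cdot]$. Maximal torus: $\mathfrak{t}(\mathfrak{n})$ denotes a maximal abelian subspace of derivations of $\mathfrak{n}$ diagonalizable over $\mathbb{R}$. Fix a basis $\{e_1,\dots,e_N\}$ of $\mathfrak{n}$ such that $\mathfrak{t}(\mathfrak{n})\subset \mathrm{Diag}(\mathfrak{n})$, the space of operators of $\mathfrak{n}$ that are diagonal in this basis; $\mathrm{Diag}(\mathfrak{n})_{>0}$ denotes the diagonal operators with all diagonal entries positive. Put $\mathfrak{t}(\mathfrak{n})_{\mathrm{tr}>0}=\{D\in\mathfrak{t}(\mathfrak{n}):\mathrm{tr}\,D>0\}$. For $\mathfrak{h}_{2n+1}$ the basis is the one given in the claim, and $\mathfrak{t}(\mathfrak{h}_{2n+1})$ is the set of all diagonal derivations $\mathrm{Diag}(d_1,d_{n+1}-d_1,\ldots,d_n,d_{n+1}-d_n,d_{n+1})$, $d_i\in\mathbb{R}$. Strongly Ricci negative derivations: a derivation $D$ of $\mathfrak{n}$ with $\mathrm{tr}\,D>0$ is strongly Ricci negative if the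 solvable Lie algebra $\mathfrak{s}_D=\mathbb{R}f\oplus\mathfrak{n}$ (semidirect product with $\mathrm{ad} f|_{\mathfrak{n}}=D$) admits an inner product such that $D^t=D$ (adjoint with respect to the restriction of the inner product to $\mathfrak{n}$), $f\perp\mathfrak{n}$, and the corresponding left-invariant metric on the simply connected Lie group with Lie algebra $\mathfrak{s}_D$ has negative definite Ricci curvature. $\mathfrak{t}(\mathfrak{n})_{srn}$ is the set of all $D\in\mathfrak{t}(\mathfrak{n})$ that are strongly Ricci negative. Moment map: $\mathrm{GL}(\mathfrak{n})$ acts on $V=\Lambda^2\mathfrak{n}^*\otimes\mathfrak{n}$ by $g\cdot\mu=g\mu(g^{-1}\cdot,g^{-1}\cdot)$, with derivative $E\cdot\mu=E\mu(\cdot,\cdot)-\mu(E\cdot,\cdot)-\mu(\cdot,E\cdot)$ for $E\in\mathfrak{gl}(\mathfrak{n})$. Endow $\mathfrak{gl}(\mathfrak{n})$ and $V$ with the inner products making $\{e_i\otimes e^j\}$ and $\{(e^i\wedge e^j)\otimes e_k: i<j\}$ orthonormal. The moment map $\mathrm{m}:V\setminus\{0\}\to\mathrm{sym}(\mathfrak{n})$ (operators symmetric with respect to the inner product making $\{e_i\}$ orthonormal) is defined by $\langle \mathrm{m}(\mu),E\rangle=\frac{1}{|\mu|^2}\langle E\cdot\mu,\mu\rangle$ for all $E\in\mathrm{sym}(\mathfrak{n})$. By convention, set $\mathrm{m}(0)=0$. The cone: let $G_{\mathfrak{t}(\mathfrak{n})}$ be the connected component of the identity of the centralizer of $\mathfrak{t}(\mathfrak{n})$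 in $\mathrm{GL}(\mathfrak{n})$. Then $$\mathcal{C}(\mathfrak{n}):=\left(\mathbb{R}_{>0}\,\mathrm{m}\left(\overline{G_{\mathfrak{t}(\mathfrak{n})}\cdot[\cdot,\cdot]}\right)\cap\mathrm{Diag}(\mathfrak{n})+\mathrm{Diag}(\mathfrak{n})_{>0}\right)\cap\mathfrak{t}(\mathfrak{n})_{\mathrm{tr}>0},$$ i.e. the set of all $D\in\mathfrak{t}(\mathfrak{n})$ with $\mathrm{tr}\,D>0$ of the form $D=r\,\mathrm{m}(\lambda)+E$ with $r>0$, $\lambda$ in the closure (in $V$) of the orbit, $\mathrm{m}(\lambda)\in\mathrm{Diag}(\mathfrak{n})$ and $E\in\mathrm{Diag}(\mathfrak{n})_{>0}$. Here $\mathbb{N}=\{1,2,\dots\}$. *)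

theory Defs
  imports "HOL-Analysis.Analysis"
begin

text \<open>
  A Lie algebra with a fixed basis is modelled on a Euclidean space \<open>'a\<close> whose canonical
  basis \<^const>\<open>Basis\<close> is that fixed basis; the standard inner product \<open>x \<bullet> y\<close> is then the one
  making it orthonormal, and the Lie bracket is a function \<open>'a \<Rightarrow> 'a \<Rightarrow> 'a\<close>.
  Function spaces carry the library's topology of pointwise convergence. On the
  finite-dimensional spaces of linear operators and of bilinear maps (both closed in the
  respective function spaces) this is the usual Euclidean topology.
\<close>

type_synonym 'a bracket = "'a \<Rightarrow> 'a \<Rightarrow> 'a"

definition lie_bracket :: "'a::euclidean_space bracket \<Rightarrow> bool" where
  "lie_bracket \<mu> \<longleftrightarrow> bilinear \<mu> \<and> (\<forall>x. \<mu> x x = 0) \<and>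
     (\<forall>x y z. \<mu> x (\<mu> y z) + \<mu> y (\<mu> z x) + \<mu> z (\<mu> x y) = 0)"

definition derivation :: "'a::euclidean_space bracket \<Rightarrow> ('a \<Rightarrow> 'a) \<Rightarrow> bool" where
  "derivation \<mu> D \<longleftrightarrow> linear D \<and> (\<forall>x y. D (\<mu> x y) = \<mu> (D x) y + \<mu> x (D y))"

definition tr :: "('a::euclidean_space \<Rightarrow> 'a) \<Rightarrow> real" where
  "tr A = (\<Sum>b\<in>Basis. A b \<bullet> b)"

definition Diag :: "('a::euclidean_space \<Rightarrow> 'a) set" where
  "Diag = {A. linear A \<and> (\<forall>b\<in>Basis. \<exists>d. A b = d *\<^sub>R b)}"

definition Diag_pos :: "('a::euclidean_space \<Rightarrow> 'a) set" where
  "Diag_pos = {A. linear A \<and> (\<forall>b\<in>Basis. \<exists>d>0. A b = d *\<^sub>R b)}"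


subsection \<open>The moment map\<close>

definition gl_act :: "('a::euclidean_space \<Rightarrow> 'a) \<Rightarrow> 'a bracket \<Rightarrow> 'a bracket" where
  "gl_act g \<mu> = (\<lambda>x y. g (\<mu> (inv g x) (inv g y)))"

definition gl_der :: "('a::euclidean_space \<Rightarrow> 'a) \<Rightarrow> 'a bracket \<Rightarrow> 'a bracket" where
  "gl_der E \<mu> = (\<lambda>x y. E (\<mu> x y) - \<mu> (E x) y - \<mu> x (E y))"

text \<open>The inner product on operators making the \<open>e\<^sub>i \<otimes> e\<^sup>j\<close> orthonormal.\<close>
definition inner_gl :: "('a::euclidean_space \<Rightarrow> 'a) \<Rightarrow> ('a \<Rightarrow> 'a) \<Rightarrow> real" where
  "inner_gl A B = (\<Sum>b\<in>Basis. A b \<bullet> B b)"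

text \<open>
  The inner product on alternating maps making the \<open>(e\<^sup>i \<and> e\<^sup>j) \<otimes> e\<^sub>k\<close> with \<open>i < j\<close> orthonormal:
  the sum runs over ordered pairs, so every \<open>i < j\<close> is counted twice, and the factor
  \<open>1/2\<close> compensates for this.
\<close>
definition inner_bracket :: "'a::euclidean_space bracket \<Rightarrow> 'a bracket \<Rightarrow> real" where
  "inner_bracket \<mu> \<nu> = 1/2 * (\<Sum>b\<in>Basis. \<Sum>c\<in>Basis. \<mu> b c \<bullet> \<nu> b c)"

definition sym_op :: "('a::euclidean_space \<Rightarrow> 'a) set" where
  "sym_op = {A. linear A \<and> (\<forall>x y. A x \<bullet> y = x \<bullet> A y)}"

definition is_moment :: "'a::euclidean_space bracket \<Rightarrow> ('a \<Rightarrow> 'a) \<Rightarrow> bool" where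
  "is_moment \<mu> M \<longleftrightarrow> M \<in> sym_op \<and>
     (\<forall>E\<in>sym_op. inner_gl M E = 1 / inner_bracket \<mu> \<mu> * inner_bracket (gl_der E \<mu>) \<mu>)"

definition moment_map :: "'a::euclidean_space bracket \<Rightarrow> 'a \<Rightarrow> 'a" where
  "moment_map \<mu> = (if \<mu> = (\<lambda>x y. 0) then (\<lambda>x. 0) else (THE M. is_moment \<mu> M))"


subsection \<open>The cone\<close>

definition centralizer_GL :: "('a::euclidean_space \<Rightarrow> 'a) set \<Rightarrow> ('a \<Rightarrow> 'a) set" where
  "centralizer_GL \<tt> = {g. linear g \<and> bij g \<and> (\<forall>D\<in>\<tt>. g \<circ> D = D \<circ> g)}"

definition G_torus :: "('a::euclidean_space \<Rightarrow> 'a) set \<Rightarrow> ('a \<Rightarrow> 'a) set" where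
  "G_torus \<tt> = connected_component_set (centralizer_GL \<tt>) id"

definition cone_C :: "'a::euclidean_space bracket \<Rightarrow> ('a \<Rightarrow> 'a) set \<Rightarrow> ('a \<Rightarrow> 'a) set" where
  "cone_C \<mu> \<tt> = {D \<in> \<tt>. tr D > 0 \<and>
     (\<exists>r>0. \<exists>\<nu> \<in> closure ((\<lambda>g. gl_act g \<mu>) ` G_torus \<tt>). \<exists>E\<in>Diag_pos.
        moment_map \<nu> \<in> Diag \<and> D = (\<lambda>x. r *\<^sub>R moment_map \<nu> x + E x))}"


subsection \<open>Ricci curvature of left-invariant metrics\<close>

definition inner_product :: "('s::euclidean_space \<Rightarrow> 's \<Rightarrow> real) \<Rightarrow> bool" where
  "inner_product ip \<longleftrightarrow> bilinear ip \<and> (\<forall>x y. ip x y = ip y x) \<and> (\<forall>x. x \<noteq> 0 \<longrightarrow> ip x x > 0)"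

text \<open>
  A left-invariant metric on a Lie group is an inner product on its Lie algebra, and its
  curvature tensors are determined by their values on left-invariant vector fields. There
  the functions \<open>\<langle>X,Y\<rangle>\<close> are constant, so the Koszul formula for the Levi-Civita connection
  reduces to the one below.
\<close>
definition is_levi_civita :: "'s::euclidean_space bracket \<Rightarrow> ('s \<Rightarrow> 's \<Rightarrow> real) \<Rightarrow> 's \<Rightarrow> 's \<Rightarrow> 's \<Rightarrow> bool" where
  "is_levi_civita br ip x y z \<longleftrightarrow>
     (\<forall>w. 2 * ip z w = ip (br x y) w - ip (br y w) x + ip (br w x) y)"

definition levi_civita :: "'s::euclidean_space bracket \<Rightarrow> ('s \<Rightarrow> 's \<Rightarrow> real) \<Rightarrow> 's \<Rightarrow> 's \<Rightarrow> 's" where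
  "levi_civita br ip x y = (THE z. is_levi_civita br ip x y z)"

definition riemann :: "'s::euclidean_space bracket \<Rightarrow> ('s \<Rightarrow> 's \<Rightarrow> real) \<Rightarrow> 's \<Rightarrow> 's \<Rightarrow> 's \<Rightarrow> 's" where
  "riemann br ip x y z =
     levi_civita br ip x (levi_civita br ip y z) - levi_civita br ip y (levi_civita br ip x z)
       - levi_civita br ip (br x y) z"

definition ricci :: "'s::euclidean_space bracket \<Rightarrow> ('s \<Rightarrow> 's \<Rightarrow> real) \<Rightarrow> 's \<Rightarrow> 's \<Rightarrow> real" where
  "ricci br ip y z = tr (\<lambda>x. riemann br ip x y z)"

text \<open>In \<open>\<real>f \<oplus> \<nn>\<close>, realised as \<open>real \<times> 'a\<close>, the vector \<open>f\<close> is \<open>(1, 0)\<close>.\<close>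
definition semidirect :: "'a::euclidean_space bracket \<Rightarrow> ('a \<Rightarrow> 'a) \<Rightarrow> (real \<times> 'a) bracket" where
  "semidirect \<mu> D = (\<lambda>(a, x) (b, y). (0, a *\<^sub>R D y - b *\<^sub>R D x + \<mu> x y))"

definition strongly_ricci_negative :: "'a::euclidean_space bracket \<Rightarrow> ('a \<Rightarrow> 'a) \<Rightarrow> bool" where
  "strongly_ricci_negative \<mu> D \<longleftrightarrow> derivation \<mu> D \<and> tr D > 0 \<and>
     (\<exists>ip. inner_product ip \<and>
        (\<forall>x y. ip (0, D x) (0, y) = ip (0, x) (0, D y)) \<and>
        (\<forall>x. ip (1, 0) (0, x) = 0) \<and>
        (\<forall>v. v \<noteq> 0 \<longrightarrow> ricci (semidirect \<mu> D) ip v v < 0))"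

definition srn :: "'a::euclidean_space bracket \<Rightarrow> ('a \<Rightarrow> 'a) set \<Rightarrow> ('a \<Rightarrow> 'a) set" where
  "srn \<mu> \<tt> = {D \<in> \<tt>. strongly_ricci_negative \<mu> D}"


subsection \<open>The Heisenberg algebra\<close>

text \<open>Here \<open>e 1, \<dots>, e (2 * n + 1)\<close> is meant to be an enumeration of \<^const>\<open>Basis\<close>.\<close>
definition heisenberg :: "nat \<Rightarrow> (nat \<Rightarrow> 'a::euclidean_space) \<Rightarrow> 'a bracket" where
  "heisenberg n e = (\<lambda>x y.
     (\<Sum>i=1..n. (x \<bullet> e (2*i-1)) * (y \<bullet> e (2*i)) - (x \<bullet> e (2*i)) * (y \<bullet> e (2*i-1)))
       *\<^sub>R e (2*n+1))"

definition heisenberg_torus :: "nat \<Rightarrow> (nat \<Rightarrow> 'a::euclidean_space) \<Rightarrow> ('a \<Rightarrow> 'a) set" where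
  "heisenberg_torus n e = {D. linear D \<and> (\<exists>d :: nat \<Rightarrow> real.
     (\<forall>i\<in>{1..n}. D (e (2*i-1)) = d i *\<^sub>R e (2*i-1) \<and>
                 D (e (2*i)) = (d (n+1) - d i) *\<^sub>R e (2*i)) \<and>
     D (e (2*n+1)) = d (n+1) *\<^sub>R e (2*n+1))}"


subsection \<open>Well-definedness\<close>

lemma is_moment_unique:
  assumes "is_moment \<mu> M" "is_moment \<mu> M'"
  shows "M = M'"
proof -
  have lin: "linear M" "linear M'" using assms by (auto simp: is_moment_def sym_op_def)
  let ?E = "\<lambda>x. M x - M' x"
  have E: "?E \<in> sym_op"
    using assms by (auto simp: is_moment_def sym_op_def linear_compose_sub inner_diff_left inner_diff_right)
  have "inner_gl M ?E = inner_gl M' ?E" using assms E by (simp add: is_moment_def)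
  hence "(\<Sum>b\<in>Basis. ?E b \<bullet> ?E b) = 0"
    by (simp add: inner_gl_def inner_diff_left sum_subtractf)
  hence "\<forall>b\<in>Basis. ?E b \<bullet> ?E b = 0"
    by (subst (asm) sum_nonneg_eq_0_iff) auto
  hence "\<And>b. b \<in> Basis \<Longrightarrow> M b = M' b" by auto
  thus ?thesis using linear_eq_stdbasis[OF lin] by auto
qed

lemma linear_eq_sum_Basis:
  fixes A :: "'a::euclidean_space \<Rightarrow> 'b::real_vector"
  assumes "linear A"
  shows "A x = (\<Sum>b\<in>Basis. (x \<bullet> b) *\<^sub>R A b)"
proof -
  have "A x = A (\<Sum>b\<in>Basis. (x \<bullet> b) *\<^sub>R b)" by (simp only: euclidean_representation)
  also have "\<dots> = (\<Sum>b\<in>Basis. (x \<bullet> b) *\<^sub>R A b)"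
    by (simp only: linear_sum[OF assms] linear_scale[OF assms])
  finally show ?thesis .
qed

lemma is_moment_exists:
  fixes \<mu> :: "'a::euclidean_space bracket"
  assumes "bilinear \<mu>"
  shows "\<exists>M. is_moment \<mu> M"
proof -
  define \<phi> where "\<phi> E = 1 / inner_bracket \<mu> \<mu> * inner_bracket (gl_der E \<mu>) \<mu>" for E
  define U where "U b c = (\<lambda>x::'a. (x \<bullet> b) *\<^sub>R c)" for b c :: 'a
  define M where "M = (\<lambda>x. \<Sum>b\<in>Basis. \<Sum>c\<in>Basis. ((x \<bullet> b) * ((\<phi> (U b c) + \<phi> (U c b)) / 2)) *\<^sub>R c)"
  have lin1: "linear (\<lambda>x. \<mu> x y)" and lin2: "linear (\<mu> y)" for y
    using assms by (auto simp: bilinear_def)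
  have \<phi>_exp: "\<phi> E = (\<Sum>b\<in>Basis. \<Sum>c\<in>Basis. (E b \<bullet> c) * \<phi> (U b c))" if "linear E" for E
  proof -
    have Eexp: "E x = (\<Sum>b\<in>Basis. \<Sum>c\<in>Basis. (E b \<bullet> c) *\<^sub>R U b c x)" for x
    proof -
      have "E x = (\<Sum>b\<in>Basis. (x \<bullet> b) *\<^sub>R E b)" by (rule linear_eq_sum_Basis[OF that])
      also have "\<dots> = (\<Sum>b\<in>Basis. (x \<bullet> b) *\<^sub>R (\<Sum>c\<in>Basis. (E b \<bullet> c) *\<^sub>R c))"
        by (simp only: euclidean_representation)
      also have "\<dots> = (\<Sum>b\<in>Basis. \<Sum>c\<in>Basis. (E b \<bullet> c) *\<^sub>R U b c x)"
        by (simp add: U_def scaleR_sum_right mult.commute)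
      finally show ?thesis .
    qed
    have der: "gl_der E \<mu> x y = (\<Sum>b\<in>Basis. \<Sum>c\<in>Basis. (E b \<bullet> c) *\<^sub>R gl_der (U b c) \<mu> x y)" for x y
      unfolding gl_der_def Eexp[of "\<mu> x y"] Eexp[of x] Eexp[of y]
      by (simp add: linear_sum[OF lin1] linear_sum[OF lin2] linear_scale[OF lin1] linear_scale[OF lin2]
            sum_subtractf scaleR_diff_right)
    have "inner_bracket (gl_der E \<mu>) \<mu>
        = (\<Sum>b\<in>Basis. \<Sum>c\<in>Basis. (E b \<bullet> c) * inner_bracket (gl_der (U b c) \<mu>) \<mu>)"
    proof -
      have "(\<Sum>x\<in>Basis. \<Sum>y\<in>Basis. gl_der E \<mu> x y \<bullet> \<mu> x y)
        = (\<Sum>x\<in>Basis. \<Sum>y\<in>Basis. \<Sum>b\<in>Basis. \<Sum>c\<in>Basis. (E b \<bullet> c) * (gl_der (U b c) \<mu> x y \<bullet> \<mu> x y))"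
        by (simp add: der inner_sum_left)
      also have "\<dots> = (\<Sum>x\<in>Basis. \<Sum>b\<in>Basis. \<Sum>y\<in>Basis. \<Sum>c\<in>Basis. (E b \<bullet> c) * (gl_der (U b c) \<mu> x y \<bullet> \<mu> x y))"
        by (intro sum.cong refl sum.swap)
      also have "\<dots> = (\<Sum>b\<in>Basis. \<Sum>x\<in>Basis. \<Sum>y\<in>Basis. \<Sum>c\<in>Basis. (E b \<bullet> c) * (gl_der (U b c) \<mu> x y \<bullet> \<mu> x y))"
        by (rule sum.swap)
      also have "\<dots> = (\<Sum>b\<in>Basis. \<Sum>x\<in>Basis. \<Sum>c\<in>Basis. \<Sum>y\<in>Basis. (E b \<bullet> c) * (gl_der (U b c) \<mu> x y \<bullet> \<mu> x y))"
        by (intro sum.cong refl sum.swap)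
      also have "\<dots> = (\<Sum>b\<in>Basis. \<Sum>c\<in>Basis. \<Sum>x\<in>Basis. \<Sum>y\<in>Basis. (E b \<bullet> c) * (gl_der (U b c) \<mu> x y \<bullet> \<mu> x y))"
        by (intro sum.cong refl sum.swap)
      finally show ?thesis
        by (simp add: inner_bracket_def sum_distrib_left mult_ac)
    qed
    thus ?thesis by (simp add: \<phi>_def sum_distrib_left sum_divide_distrib mult_ac)
  qed
  have linM: "linear M"
    unfolding M_def
    by (intro linear_compose_sum ballI linearI)
       (simp_all add: inner_add_left distrib_right flip: scaleR_add_left)
  have Mbc: "M b \<bullet> c = (\<phi> (U b c) + \<phi> (U c b)) / 2" if "b \<in> Basis" "c \<in> Basis" for b c
  proof -
    have "M b \<bullet> c = (\<Sum>b'\<in>Basis. \<Sum>c'\<in>Basis. ((b \<bullet> b') * ((\<phi> (U b' c') + \<phi> (U c' b')) / 2)) * (c' \<bullet> c))"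
      by (simp add: M_def inner_sum_left)
    also have "\<dots> = (\<Sum>b'\<in>Basis. \<Sum>c'\<in>Basis. if c' = c then if b' = b then (\<phi> (U b c) + \<phi> (U c b)) / 2 else 0 else 0)"
      by (intro sum.cong refl) (simp add: inner_Basis that)
    also have "\<dots> = (\<phi> (U b c) + \<phi> (U c b)) / 2"
      using that by simp
    finally show ?thesis .
  qed
  have symM: "M x \<bullet> y = x \<bullet> M y" for x y
  proof -
    have *: "M x \<bullet> y = (\<Sum>b\<in>Basis. \<Sum>c\<in>Basis. (x \<bullet> b) * (y \<bullet> c) * (M b \<bullet> c))" for x y
    proof -
      have "M x \<bullet> y = (\<Sum>b\<in>Basis. (x \<bullet> b) * (M b \<bullet> y))"
        using linear_eq_sum_Basis[OF linM, of x] by (simp add: inner_sum_left)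
      also have "\<dots> = (\<Sum>b\<in>Basis. (x \<bullet> b) * (\<Sum>c\<in>Basis. (M b \<bullet> c) * (y \<bullet> c)))"
        by (subst euclidean_inner) simp
      finally show ?thesis by (simp add: sum_distrib_left mult_ac)
    qed
    have "M x \<bullet> y = (\<Sum>b\<in>Basis. \<Sum>c\<in>Basis. (y \<bullet> c) * (x \<bullet> b) * (M c \<bullet> b))"
      unfolding *[of x y] by (intro sum.cong refl) (simp add: Mbc)
    also have "\<dots> = M y \<bullet> x"
      unfolding *[of y x] by (rule sum.swap)
    finally show ?thesis by (simp add: inner_commute)
  qed
  have "inner_gl M E = \<phi> E" if E: "E \<in> sym_op" for E
  proof -
    have linE: "linear E" and symE: "E x \<bullet> y = E y \<bullet> x" for x y
      using E by (auto simp: sym_op_def inner_commute)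
    have "inner_gl M E = (\<Sum>b\<in>Basis. \<Sum>c\<in>Basis. (M b \<bullet> c) * (E b \<bullet> c))"
      unfolding inner_gl_def by (subst euclidean_inner) simp
    also have "\<dots> = (\<Sum>b\<in>Basis. \<Sum>c\<in>Basis. (E b \<bullet> c) * \<phi> (U b c) / 2 + (E b \<bullet> c) * \<phi> (U c b) / 2)"
      by (intro sum.cong refl) (simp add: Mbc field_simps)
    also have "\<dots> = \<phi> E / 2 + (\<Sum>b\<in>Basis. \<Sum>c\<in>Basis. (E c \<bullet> b) * \<phi> (U c b) / 2)"
      by (simp add: \<phi>_exp[OF linE] sum.distrib sum_divide_distrib symE)
    also have "(\<Sum>b\<in>Basis. \<Sum>c\<in>Basis. (E c \<bullet> b) * \<phi> (U c b) / 2) = \<phi> E / 2"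
      by (subst sum.swap) (simp add: \<phi>_exp[OF linE] sum_divide_distrib)
    finally show ?thesis by simp
  qed
  hence "is_moment \<mu> M"
    using linM symM by (simp add: is_moment_def sym_op_def \<phi>_def)
  thus ?thesis by blast
qed

lemma moment_map_works:
  assumes "bilinear \<mu>" "\<mu> \<noteq> (\<lambda>x y. 0)"
  shows "is_moment \<mu> (moment_map \<mu>)"
proof -
  obtain M where M: "is_moment \<mu> M" using is_moment_exists[OF assms(1)] ..
  have "is_moment \<mu> (THE M. is_moment \<mu> M)"
    using M is_moment_unique[OF _ M] by (rule theI[where P = "is_moment \<mu>"])
  thus ?thesis using assms(2) by (simp add: moment_map_def)
qed

lemma levi_civita_ex1:
  assumes ip: "inner_product ip" and br: "bilinear br"
  shows "\<exists>!z. is_levi_civita br ip x y z"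
proof (rule ex_ex1I)
  have lin: "linear (ip z)" "linear (\<lambda>z. ip z w)" for z w
    using ip by (auto simp: inner_product_def bilinear_def)
  have lb: "linear (br z)" "linear (\<lambda>z. br z w)" for z w
    using br by (auto simp: bilinear_def)
  have ip_simps: "ip (u + v) w = ip u w + ip v w" "ip w (u + v) = ip w u + ip w v"
      "ip (c *\<^sub>R u) w = c * ip u w" "ip w (c *\<^sub>R u) = c * ip w u"
      "br (u + v) w = br u w + br v w" "br w (u + v) = br w u + br w v"
      "br (c *\<^sub>R u) w = c *\<^sub>R br u w" "br w (c *\<^sub>R u) = c *\<^sub>R br w u" for u v w c
    using linear_add[OF lin(1)] linear_add[OF lin(2)] linear_add[OF lb(1)] linear_add[OF lb(2)]
      linear_scale[OF lin(1)] linear_scale[OF lin(2)] linear_scale[OF lb(1)] linear_scale[OF lb(2)]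
    by simp_all
  have pos: "z \<noteq> 0 \<Longrightarrow> ip z z > 0" for z
    using ip by (auto simp: inner_product_def)
  define J where "J z = (\<Sum>b\<in>Basis. ip z b *\<^sub>R b)" for z
  have Jw: "J z \<bullet> w = ip z w" for z w
  proof -
    have "ip z w = (\<Sum>b\<in>Basis. (w \<bullet> b) * ip z b)"
      using linear_eq_sum_Basis[OF lin(1), of z w] by simp
    thus ?thesis by (simp add: J_def inner_sum_left inner_commute[of w] mult.commute)
  qed
  have linJ: "linear J"
    unfolding J_def by (intro linear_compose_sum ballI linearI)
      (simp_all add: ip_simps algebra_simps)
  have "inj J"
  proof (rule linear_injective_0[THEN iffD2, OF linJ], intro allI impI)
    fix z assume "J z = 0"
    hence "ip z z = 0" using Jw[of z z] by simp
    thus "z = 0" using pos[of z] by force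
  qed
  hence "surj J" using linear_injective_imp_surjective[OF linJ] by auto
  define L where "L w = (ip (br x y) w - ip (br y w) x + ip (br w x) y) / 2" for w
  have linL: "linear L"
    unfolding L_def by (intro linearI) (simp_all add: ip_simps field_simps)
  obtain z where z: "J z = (\<Sum>b\<in>Basis. L b *\<^sub>R b)"
    using \<open>surj J\<close> by (metis surjD)
  have "ip z w = L w" for w
  proof -
    have "L w = (\<Sum>b\<in>Basis. (w \<bullet> b) * L b)"
      using linear_eq_sum_Basis[OF linL, of w] by simp
    thus ?thesis by (simp add: Jw[symmetric] z inner_sum_left inner_commute[of w] mult.commute)
  qed
  hence "is_levi_civita br ip x y z"
    unfolding is_levi_civita_def by (simp only: L_def) simp
  thus "\<exists>z. is_levi_civita br ip x y z" by (rule exI)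
  fix z z' assume "is_levi_civita br ip x y z" "is_levi_civita br ip x y z'"
  hence "ip z (z - z') = ip z' (z - z')" unfolding is_levi_civita_def by (smt (verit))
  hence "ip (z - z') (z - z') = 0" by (simp add: linear_diff[OF lin(2)])
  thus "z = z'" using pos[of "z - z'"] by force
qed


subsection \<open>The Heisenberg bracket and its torus\<close>

lemma lie_bracket_heisenberg:
  assumes "bij_betw e {1..2*n+1} Basis"
  shows "lie_bracket (heisenberg n e)"
    and "heisenberg n e (heisenberg n e x y) z = 0"
proof -
  have inj: "inj_on e {1..2*n+1}" and B: "\<And>i. i \<in> {1..2*n+1} \<Longrightarrow> e i \<in> Basis"
    using assms by (auto simp: bij_betw_def)
  have ip: "e (2*n+1) \<bullet> e i = 0" if "i \<in> {1..2*n}" for i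
  proof -
    have "e (2*n+1) \<noteq> e i"
      using inj that by (auto dest!: inj_onD)
    thus ?thesis using that B by (simp add: inner_not_same_Basis)
  qed
  have i: "2*i-1 \<in> {1..2*n}" "2*i \<in> {1..2*n}" if "i \<in> {1..n}" for i using that by auto
  have z1: "heisenberg n e (c *\<^sub>R e (2*n+1)) z = 0" for c z
    unfolding heisenberg_def using ip i by simp
  have z2: "heisenberg n e z (c *\<^sub>R e (2*n+1)) = 0" for c z
    unfolding heisenberg_def using ip i by simp
  have f: "\<exists>c. heisenberg n e x y = c *\<^sub>R e (2*n+1)" for x y
    unfolding heisenberg_def by blast
  show 2: "heisenberg n e (heisenberg n e x y) z = 0" for x y z
    using f[of x y] z1 by auto
  have 3: "heisenberg n e z (heisenberg n e x y) = 0" for x y z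
    using f[of x y] z2 by auto
  have "bilinear (heisenberg n e)"
    unfolding bilinear_def heisenberg_def
    by (intro conjI allI linearI)
       (simp_all add: inner_add_left algebra_simps sum.distrib sum_subtractf
          sum_distrib_left flip: scaleR_add_left scaleR_diff_left)
  moreover have "heisenberg n e x x = 0" for x
    by (simp add: heisenberg_def mult.commute)
  ultimately show "lie_bracket (heisenberg n e)"
    by (simp add: lie_bracket_def 3)
qed

lemma heisenberg_index_cases:
  fixes k n :: nat
  assumes "k \<in> {1..2*n+1}"
  obtains i where "i \<in> {1..n}" "k = 2*i-1" | i where "i \<in> {1..n}" "k = 2*i" | "k = 2*n+1"
proof (cases "k = 2*n+1")
  case False
  with assms have k: "1 \<le> k" "k \<le> 2*n" by auto
  show thesis
  proof (cases "even k")
    case True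
    then obtain i where "k = 2*i" by (elim evenE)
    with k that(2)[of i] show thesis by auto
  next
    case False
    then obtain i where "k = 2*i+1" by (elim oddE)
    with k that(1)[of "i+1"] show thesis by auto
  qed
qed (use that in auto)

lemma heisenberg_torus_eq_Diag_derivations:
  fixes e :: "nat \<Rightarrow> 'a::euclidean_space"
  assumes n: "n \<ge> 1" and e: "bij_betw e {1..2*n+1} Basis"
  shows "heisenberg_torus n e = {D \<in> Diag. derivation (heisenberg n e) D}"
proof -
  let ?\<mu> = "heisenberg n e"
  have B: "Basis = e ` {1..2*n+1}" using e by (simp add: bij_betw_def)
  have ee: "e i \<bullet> e j = (if i = j then 1 else 0)" if "i \<in> {1..2*n+1}" "j \<in> {1..2*n+1}" for i j
  proof -
    have "e i \<in> Basis" "e j \<in> Basis" "e i = e j \<longleftrightarrow> i = j"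
      using that e by (auto simp: bij_betw_def inj_on_def)
    thus ?thesis by (simp add: inner_Basis)
  qed
  have br: "?\<mu> (e (2*i-1)) (e (2*i)) = e (2*n+1)" if i: "i \<in> {1..n}" for i
  proof -
    have "(\<Sum>j=1..n. (e (2*i-1) \<bullet> e (2*j-1)) * (e (2*i) \<bullet> e (2*j))
            - (e (2*i-1) \<bullet> e (2*j)) * (e (2*i) \<bullet> e (2*j-1))) = (\<Sum>j=1..n. if j = i then 1 else (0::real))"
    proof (intro sum.cong refl)
      fix j assume "j \<in> {1..n}"
      with i have r: "2*i-1 \<in> {1..2*n+1}" "2*i \<in> {1..2*n+1}" "2*j-1 \<in> {1..2*n+1}" "2*j \<in> {1..2*n+1}"
        by auto
      have "2*i-1 \<noteq> 2*j" using i by (cases i) (auto, presburger)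
      moreover have "(2*i-1 = 2*j-1) = (i = j)" using r by auto
      ultimately
      show "(e (2*i-1) \<bullet> e (2*j-1)) * (e (2*i) \<bullet> e (2*j))
            - (e (2*i-1) \<bullet> e (2*j)) * (e (2*i) \<bullet> e (2*j-1)) = (if j = i then 1 else 0)"
        by (simp only: ee[OF r(1) r(3)] ee[OF r(2) r(4)] ee[OF r(1) r(4)]) auto
    qed
    thus ?thesis using i by (simp add: heisenberg_def)
  qed
  have bil: "bilinear ?\<mu>" using lie_bracket_heisenberg(1)[OF e] by (simp add: lie_bracket_def)
  show ?thesis
  proof (intro equalityI subsetI)
    fix D assume "D \<in> heisenberg_torus n e"
    then obtain d where lin: "linear D"
      and d: "\<And>i. i \<in> {1..n} \<Longrightarrow> D (e (2*i-1)) = d i *\<^sub>R e (2*i-1)"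
        "\<And>i. i \<in> {1..n} \<Longrightarrow> D (e (2*i)) = (d (n+1) - d i) *\<^sub>R e (2*i)"
        "D (e (2*n+1)) = d (n+1) *\<^sub>R e (2*n+1)"
      unfolding heisenberg_torus_def by blast
    have diag: "\<exists>c. D (e k) = c *\<^sub>R e k" if "k \<in> {1..2*n+1}" for k
      using that by (cases rule: heisenberg_index_cases) (use d in blast)+
    hence D: "D \<in> Diag" using lin by (auto simp: Diag_def B)
    have Dk: "D x \<bullet> e k = c * (x \<bullet> e k)" if k: "k \<in> {1..2*n+1}" and c: "D (e k) = c *\<^sub>R e k" for x k c
    proof -
      have "D x \<bullet> e k = (\<Sum>b\<in>Basis. (x \<bullet> b) * (D b \<bullet> e k))"
        using linear_eq_sum_Basis[OF lin, of x] by (simp add: inner_sum_left)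
      also have "\<dots> = (\<Sum>b\<in>Basis. if b = e k then (x \<bullet> e k) * c else 0)"
      proof (intro sum.cong refl)
        fix b assume "b \<in> (Basis :: 'a set)"
        then obtain j where j: "j \<in> {1..2*n+1}" "b = e j" unfolding B by blast
        obtain c' where c': "D (e j) = c' *\<^sub>R e j" using diag[OF j(1)] ..
        have "e j = e k \<longleftrightarrow> j = k" using e j(1) k by (auto simp: bij_betw_def inj_on_def)
        thus "(x \<bullet> b) * (D b \<bullet> e k) = (if b = e k then (x \<bullet> e k) * c else 0)"
          using ee[OF j(1) k] j(2) c' c ee[OF k k] by auto
      qed
      also have "\<dots> = c * (x \<bullet> e k)"
        using imageI[OF k, of e] unfolding B[symmetric] by simp
      finally show ?thesis .
    qed
    have r: "2*i-1 \<in> {1..2*n+1}" "2*i \<in> {1..2*n+1}" if "i \<in> {1..n}" for i using that by auto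
    have "D (?\<mu> x y) = ?\<mu> (D x) y + ?\<mu> x (D y)" for x y
    proof -
      have "D (?\<mu> x y) = ((\<Sum>i=1..n. (x \<bullet> e (2*i-1)) * (y \<bullet> e (2*i)) - (x \<bullet> e (2*i)) * (y \<bullet> e (2*i-1)))
          * d (n+1)) *\<^sub>R e (2*n+1)"
        unfolding heisenberg_def linear_scale[OF lin] d(3) by simp
      also have "\<dots> = ?\<mu> (D x) y + ?\<mu> x (D y)"
        unfolding heisenberg_def scaleR_add_left[symmetric] sum.distrib[symmetric] sum_distrib_right
        by (intro arg_cong[where f = "\<lambda>c. c *\<^sub>R e (2*n+1)"] sum.cong refl)
           (simp only: Dk[OF r(1) d(1)] Dk[OF r(2) d(2)], algebra)
      finally show ?thesis .
    qed
    thus "D \<in> {D \<in> Diag. derivation ?\<mu> D}" using D lin by (simp add: derivation_def)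
  next
    fix D assume "D \<in> {D \<in> Diag. derivation ?\<mu> D}"
    hence lin: "linear D" and "\<forall>k\<in>{1..2*n+1}. \<exists>c. D (e k) = c *\<^sub>R e k"
      and der: "\<And>x y. D (?\<mu> x y) = ?\<mu> (D x) y + ?\<mu> x (D y)"
      by (auto simp: Diag_def derivation_def B)
    then obtain c where c: "\<And>k. k \<in> {1..2*n+1} \<Longrightarrow> D (e k) = c k *\<^sub>R e k" by metis
    have c': "c (2*n+1) = c (2*i-1) + c (2*i)" if i: "i \<in> {1..n}" for i
    proof -
      have r: "2*i-1 \<in> {1..2*n+1}" "2*i \<in> {1..2*n+1}" "2*n+1 \<in> {1..2*n+1}" using i by auto
      have "c (2*n+1) *\<^sub>R e (2*n+1) = (c (2*i-1) + c (2*i)) *\<^sub>R e (2*n+1)"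
        using der[of "e (2*i-1)" "e (2*i)"] bil br[OF i] c[OF r(1)] c[OF r(2)] c[OF r(3)]
        by (simp add: bilinear_lmul bilinear_rmul scaleR_add_left)
      moreover have "e (2*n+1) \<noteq> 0" using ee[OF r(3) r(3)] by auto
      ultimately show ?thesis by (simp only: scaleR_cancel_right) simp
    qed
    show "D \<in> heisenberg_torus n e"
      unfolding heisenberg_torus_def
    proof (intro CollectI conjI lin exI[of _ "\<lambda>i. if i = n+1 then c (2*n+1) else c (2*i-1)"] ballI)
      fix i assume i: "i \<in> {1..n}"
      hence r: "2*i-1 \<in> {1..2*n+1}" "2*i \<in> {1..2*n+1}" "i \<noteq> n+1" by auto
      show "D (e (2*i-1)) = (if i = n+1 then c (2*n+1) else c (2*i-1)) *\<^sub>R e (2*i-1)"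
        using c[OF r(1)] r(3) by simp
      show "D (e (2*i)) = ((if n+1 = n+1 then c (2*n+1) else c (2*(n+1)-1)) -
          (if i = n+1 then c (2*n+1) else c (2*i-1))) *\<^sub>R e (2*i)"
        using c[OF r(2)] r(3) c'[OF i] by simp
    qed (use c[of "2*n+1"] in simp)
  qed
qed

text \<open>
  The torus is maximal: an operator commuting with all of it is already diagonal, so a
  derivation with that property lies in it.
\<close>
lemma heisenberg_torus_maximal:
  fixes e :: "nat \<Rightarrow> 'a::euclidean_space"
  assumes n: "n \<ge> 1" and e: "bij_betw e {1..2*n+1} Basis"
    and A: "derivation (heisenberg n e) A" and comm: "\<And>D. D \<in> heisenberg_torus n e \<Longrightarrow> A \<circ> D = D \<circ> A"
  shows "A \<in> heisenberg_torus n e"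
proof -
  have B: "Basis = e ` {1..2*n+1}" using e by (simp add: bij_betw_def)
  have inj: "e i = e j \<longleftrightarrow> i = j" if "i \<in> {1..2*n+1}" "j \<in> {1..2*n+1}" for i j
    using that e by (auto simp: bij_betw_def inj_on_def)
  have in_Basis: "\<exists>j\<in>{1..2*n+1}. b = e j" if "b \<in> Basis" for b
    using that by (auto simp: B)
  define w :: "nat \<Rightarrow> real" where
    "w k = (if k = 2*n+1 then 1 else if odd k then - real ((k+1) div 2) else 1 + real (k div 2))" for k
  have w: "w k \<noteq> w j" if "j \<noteq> k" "k \<ge> 1" "j \<ge> 1" for j k
    using that by (auto simp: w_def elim!: evenE oddE)
  define D where "D x = (\<Sum>k=1..2*n+1. (w k * (x \<bullet> e k)) *\<^sub>R e k)" for x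
  have lin: "linear D"
    unfolding D_def by (intro linear_compose_sum ballI linearI) (simp_all add: inner_add_left algebra_simps)
  have De: "D (e j) = w j *\<^sub>R e j" if j: "j \<in> {1..2*n+1}" for j
  proof -
    have "D (e j) = (\<Sum>k=1..2*n+1. if k = j then w j *\<^sub>R e j else 0)"
      unfolding D_def
    proof (intro sum.cong refl)
      fix k assume k: "k \<in> {1..2*n+1}"
      have "e j \<in> Basis" "e k \<in> Basis" using j k B by auto
      thus "(w k * (e j \<bullet> e k)) *\<^sub>R e k = (if k = j then w j *\<^sub>R e j else 0)"
        using inj[OF j k] by (auto simp: inner_Basis)
    qed
    thus ?thesis using j by simp
  qed
  have "D \<in> heisenberg_torus n e"
    unfolding heisenberg_torus_def
  proof (intro CollectI conjI lin exI[of _ "\<lambda>i. if i = n+1 then 1 else - real i"] ballI)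
    fix i assume i: "i \<in> {1..n}"
    hence r: "2*i-1 \<in> {1..2*n+1}" "2*i \<in> {1..2*n+1}" "i \<noteq> n+1" "2*i-1 \<noteq> 2*n+1" "odd (2*i-1)" by auto
    hence "w (2*i-1) = - real i" "w (2*i) = 1 + real i" by (simp_all add: w_def, presburger+)
    thus "D (e (2*i-1)) = (if i = n+1 then 1 else - real i) *\<^sub>R e (2*i-1)"
      and "D (e (2*i)) = ((if n+1 = n+1 then 1 else - real (n+1)) - (if i = n+1 then 1 else - real i)) *\<^sub>R e (2*i)"
      using De[OF r(1)] De[OF r(2)] r(3) by simp_all
  qed (use De[of "2*n+1"] in \<open>simp add: w_def\<close>)
  hence AD: "A (D x) = D (A x)" for x using comm by (metis comp_apply)
  have linA: "linear A" using A by (simp add: derivation_def)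
  have "\<exists>d. A b = d *\<^sub>R b" if "b \<in> Basis" for b
  proof -
    obtain j where j: "j \<in> {1..2*n+1}" "b = e j" using in_Basis \<open>b \<in> Basis\<close> by blast
    have z: "A b \<bullet> c = 0" if "c \<in> Basis" "c \<noteq> b" for c
    proof -
      obtain k where k: "k \<in> {1..2*n+1}" "c = e k" using in_Basis \<open>c \<in> Basis\<close> by blast
      have "D (A b) \<bullet> c = (\<Sum>i=1..2*n+1. (w i * (A b \<bullet> e i)) * (e i \<bullet> e k))"
        by (simp only: D_def inner_sum_left k(2) inner_scaleR_left)
      also have "\<dots> = (\<Sum>i=1..2*n+1. if i = k then w k * (A b \<bullet> e k) else 0)"
      proof (intro sum.cong refl)
        fix i assume i: "i \<in> {1..2*n+1}"
        have "e i \<in> Basis" "e k \<in> Basis" using i k B by auto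
        thus "(w i * (A b \<bullet> e i)) * (e i \<bullet> e k) = (if i = k then w k * (A b \<bullet> e k) else 0)"
          using inj[OF i k(1)] by (auto simp: inner_Basis)
      qed
      also have "\<dots> = w k * (A b \<bullet> c)" using k by simp
      finally have "D (A b) \<bullet> c = w k * (A b \<bullet> c)" .
      moreover have "D (A b) = w j *\<^sub>R A b"
        using AD[of b] j De[OF j(1)] by (simp add: linear_scale[OF linA])
      ultimately have "w j * (A b \<bullet> c) = w k * (A b \<bullet> c)" by simp
      moreover have "w j \<noteq> w k" using w[of k j] j k that by auto
      ultimately show ?thesis by simp
    qed
    have b: "b \<in> Basis" by fact
    have "A b = (\<Sum>c\<in>Basis. (A b \<bullet> c) *\<^sub>R c)" by (simp add: euclidean_representation)
    also have "\<dots> = (\<Sum>c\<in>Basis. if c = b then (A b \<bullet> b) *\<^sub>R b else 0)"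
      using z by (intro sum.cong refl) auto
    finally show ?thesis using that by auto
  qed
  thus ?thesis
    using A linA by (simp add: heisenberg_torus_eq_Diag_derivations[OF n e] Diag_def)
qed

end

theory Submission imports Defs begin

text \<open>
  Write \<open>D = Diag(d\<^sub>1, d - d\<^sub>1, \<dots>, d\<^sub>n, d - d\<^sub>n, d)\<close>. Both sides consist of the \<open>D\<close> for which there are
  \<open>\<beta>\<^sub>i \<ge> 0\<close> with \<open>d\<^sub>i + \<beta>\<^sub>i \<ge> 0\<close>, \<open>d - d\<^sub>i + \<beta>\<^sub>i \<ge> 0\<close> and \<open>\<Sum>\<beta>\<^sub>i < d\<close>; since the last inequality is strict,
  the others can be made strict too by enlarging the \<open>\<beta>\<^sub>i\<close> slightly.

  The centraliser of the torus is diagonal, so the orbit closure consists of brackets with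
  \<open>\<mu>(e\<^sub>2\<^sub>i\<^sub>-\<^sub>1, e\<^sub>2\<^sub>i) = a\<^sub>i e\<^sub>2\<^sub>n\<^sub>+\<^sub>1\<close>, whose moment map is
  \<open>Diag(-a\<^sub>1\<^sup>2, -a\<^sub>1\<^sup>2, \<dots>, \<Sum>a\<^sub>i\<^sup>2) / \<Sum>a\<^sub>i\<^sup>2\<close>; put \<open>\<beta>\<^sub>i = r a\<^sub>i\<^sup>2 / \<Sum>a\<^sub>j\<^sup>2\<close>.

  The Ricci curvature on \<open>\<nn>\<close> of a metric as in the definition of strongly Ricci negative is
  \<open>Ric\<^sub>\<nn> - tr(D) D / |f|\<^sup>2\<close>. For a diagonal metric \<open>Ric\<^sub>\<nn>\<close> is a positive multiple of a moment map as above.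
  For an arbitrary one, compare the traces of \<open>Ric\<^sub>\<nn>\<close> and \<open>D\<close> over the negative eigenvectors of \<open>D\<close>.
\<close>

section \<open>Ricci curvature of one-dimensional extensions\<close>

text \<open>Expanding each vector of \<open>Basis\<close> in the frame \<open>X\<close> and swapping
  the two sums carries the trace, defined through \<open>Basis\<close>, over to a frame adapted to
  the metric, where the curvature is computed.\<close>

lemma tr_expansion:
  fixes A :: "'a::euclidean_space \<Rightarrow> 'a"
  assumes g: "bilinear g" and A: "linear A"
    and X: "\<And>x. (\<Sum>j\<in>I. g x (X j) *\<^sub>R X j) = x"
  shows "tr A = (\<Sum>j\<in>I. g (A (X j)) (X j))"
proof -
  have l: "linear (\<lambda>x. g x y)" for y using g by (simp add: bilinear_def)
  have "tr A = (\<Sum>b\<in>Basis. \<Sum>j\<in>I. g b (X j) * (A (X j) \<bullet> b))"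
    unfolding tr_def
  proof (intro sum.cong refl)
    fix b :: 'a
    have "A b = A (\<Sum>j\<in>I. g b (X j) *\<^sub>R X j)" using X[of b] by simp
    also have "\<dots> = (\<Sum>j\<in>I. g b (X j) *\<^sub>R A (X j))"
      by (simp add: linear_sum[OF A] linear_scale[OF A])
    finally show "A b \<bullet> b = (\<Sum>j\<in>I. g b (X j) * (A (X j) \<bullet> b))"
      by (simp add: inner_sum_left)
  qed
  also have "\<dots> = (\<Sum>j\<in>I. \<Sum>b\<in>Basis. (A (X j) \<bullet> b) * g b (X j))"
    by (subst sum.swap) (simp add: mult.commute)
  also have "\<dots> = (\<Sum>j\<in>I. g (A (X j)) (X j))"
    by (intro sum.cong refl) (simp add: linear_eq_sum_Basis[OF l, of "A (X _)"])
  finally show ?thesis .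
qed

lemma tr_prod:
  fixes A :: "real \<times> 'a::euclidean_space \<Rightarrow> real \<times> 'a"
  shows "tr A = fst (A (1, 0)) + tr (\<lambda>x. snd (A (0, x)))"
proof -
  have "tr A = (\<Sum>b\<in>(\<lambda>u. (u, 0)) ` Basis. A b \<bullet> b) + (\<Sum>b\<in>(\<lambda>u. (0, u)) ` Basis. A b \<bullet> b)"
    unfolding tr_def Basis_prod_def by (rule sum.union_disjoint) auto
  also have "\<dots> = fst (A (1, 0)) + tr (\<lambda>x. snd (A (0, x)))"
    by (subst sum.reindex, simp add: inj_on_def)+ (simp add: tr_def inner_prod_def)
  finally show ?thesis .
qed

lemma bilinear_restrict_snd:
  fixes ip :: "real \<times> 'a::euclidean_space \<Rightarrow> real \<times> 'a \<Rightarrow> real"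
  assumes "inner_product ip"
  shows "bilinear (\<lambda>x y. ip (0, x) (0, y))"
  unfolding bilinear_def
proof (intro conjI allI)
  have l: "linear (\<lambda>x. (0::real, x::'a))" by (intro linearI) simp_all
  fix x
  show "linear (\<lambda>y. ip (0, x) (0, y))" "linear (\<lambda>y. ip (0, y) (0, x))"
    using assms linear_compose[OF l, of "ip (0, x)"] linear_compose[OF l, of "\<lambda>y. ip y (0, x)"]
    by (simp_all add: inner_product_def bilinear_def o_def)
qed

text \<open>General enough for two uses with the Heisenberg form as \<omega>: an arbitrary metric
  with \<open>D\<close> self-adjoint, and an explicit diagonal one. In both, \<open>X\<close> is an
  orthonormal eigenframe of \<open>D\<close> and \<open>c\<close> its eigenvalues.\<close>

locale metric_extension =
  fixes ip :: "real \<times> 'a::euclidean_space \<Rightarrow> real \<times> 'a \<Rightarrow> real"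
    and D :: "'a \<Rightarrow> 'a" and \<omega> :: "'a \<Rightarrow> 'a \<Rightarrow> real" and z :: 'a
    and I :: "'i set" and X :: "'i \<Rightarrow> 'a" and c :: "'i \<Rightarrow> real" and d :: real
  assumes ip: "inner_product ip"
    and ip_f: "\<And>x. ip (1, 0) (0, x) = 0"
    and X_expansion: "\<And>x. (\<Sum>j\<in>I. ip (0, x) (0, X j) *\<^sub>R X j) = x"
    and X_unit: "\<And>j. j \<in> I \<Longrightarrow> ip (0, X j) (0, X j) = 1"
    and linD: "linear D"
    and DX: "\<And>j. j \<in> I \<Longrightarrow> D (X j) = c j *\<^sub>R X j"
    and bil\<omega>: "bilinear \<omega>"
    and skew: "\<And>x y. \<omega> x y = - \<omega> y x"
    and D_self_adjoint: "\<And>x y. ip (0, D x) (0, y) = ip (0, x) (0, D y)"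
    and \<omega>z: "\<And>x. \<omega> z x = 0"
    and Dz: "D z = d *\<^sub>R z"
begin

section \<open>Closed form of the Levi-Civita connection\<close>

definition g :: "'a \<Rightarrow> 'a \<Rightarrow> real" where "g x y = ip (0, x) (0, y)"
definition h :: real where "h = ip (1, 0) (1, 0)"
text \<open>The skew operator representing \<omega> with respect to the metric; see
  \<open>gJ\<close>.\<close>

definition J :: "'a \<Rightarrow> 'a" where "J x = (\<Sum>j\<in>I. \<omega> x (X j) *\<^sub>R X j)"

text \<open>The Koszul formula solved for the connection. The \<open>f\<close>-component of
  \<open>v\<close> is absent: as \<open>D\<close> is self-adjoint, covariant differentiation in
  direction \<open>f\<close> vanishes on left-invariant fields.\<close>

definition conn :: "real \<times> 'a \<Rightarrow> real \<times> 'a \<Rightarrow> real \<times> 'a" where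
  "conn v w = (g (D (snd v)) (snd w) / h,
     (1/2) *\<^sub>R (\<omega> (snd v) (snd w) *\<^sub>R z - g z (snd v) *\<^sub>R J (snd w) - g z (snd w) *\<^sub>R J (snd v))
       - fst w *\<^sub>R D (snd v))"

abbreviation br :: "(real \<times> 'a) bracket" where
  "br \<equiv> semidirect (\<lambda>x y. \<omega> x y *\<^sub>R z) D"

lemma bil_ip: "bilinear ip" and ip_sym: "ip v w = ip w v"
  using ip unfolding inner_product_def by blast+

lemma h_pos: "h > 0"
  using ip by (auto simp: inner_product_def h_def zero_prod_def)

lemma bil_g: "bilinear g"
  using bilinear_restrict_snd[OF ip] by (simp add: g_def[abs_def])

lemma g_sym: "g x y = g y x"
  by (simp add: g_def ip_sym)

lemmas g_simps = bilinear_ladd[OF bil_g] bilinear_radd[OF bil_g] bilinear_lmul[OF bil_g]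
  bilinear_rmul[OF bil_g] bilinear_lsub[OF bil_g] bilinear_rsub[OF bil_g]
  bilinear_lneg[OF bil_g] bilinear_rneg[OF bil_g] bilinear_lzero[OF bil_g] bilinear_rzero[OF bil_g]

lemmas \<omega>_simps = bilinear_ladd[OF bil\<omega>] bilinear_radd[OF bil\<omega>] bilinear_lmul[OF bil\<omega>]
  bilinear_rmul[OF bil\<omega>] bilinear_lsub[OF bil\<omega>] bilinear_rsub[OF bil\<omega>]
  bilinear_lneg[OF bil\<omega>] bilinear_rneg[OF bil\<omega>] bilinear_lzero[OF bil\<omega>] bilinear_rzero[OF bil\<omega>]

lemma X_exp: "(\<Sum>j\<in>I. g x (X j) *\<^sub>R X j) = x"
  using X_expansion[of x] by (simp add: g_def)

text \<open>A sum weighted by the frame coefficients of a vector is the value of the linear form at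
  that vector. The sums \<open>s1\<close> to \<open>s5\<close> of the Ricci computation are
  contracted in this way.\<close>

lemma lin_exp:
  assumes "linear (f :: 'a \<Rightarrow> real)"
  shows "(\<Sum>j\<in>I. g x (X j) * f (X j)) = f x"
proof -
  have "f x = f (\<Sum>j\<in>I. g x (X j) *\<^sub>R X j)" by (simp add: X_exp)
  thus ?thesis by (simp add: linear_sum[OF assms] linear_scale[OF assms])
qed

lemma lin_\<omega>: "linear (\<omega> x)" "linear (\<lambda>y. \<omega> y x)" and lin_g: "linear (g x)" "linear (\<lambda>y. g y x)"
  using bil\<omega> bil_g by (auto simp: bilinear_def)

lemma ip_eq: "ip (a, x) (b, y) = a * b * h + g x y"
proof -
  have e: "(a, x) = a *\<^sub>R (1, 0) + (0, x)" for a and x :: 'a by simp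
  show ?thesis
    unfolding e[of a x] e[of b y]
      bilinear_ladd[OF bil_ip] bilinear_radd[OF bil_ip] bilinear_lmul[OF bil_ip] bilinear_rmul[OF bil_ip]
    using ip_f ip_sym[of "(0, x)" "(1, 0)"] by (simp add: h_def g_def)
qed

lemma gJ: "g (J x) y = \<omega> x y"
proof -
  have "g (J x) y = (\<Sum>j\<in>I. \<omega> x (X j) * g (X j) y)"
    unfolding J_def by (simp add: linear_sum[OF lin_g(2)] g_simps)
  also have "\<dots> = (\<Sum>j\<in>I. g y (X j) * \<omega> x (X j))"
    by (intro sum.cong refl) (metis g_sym mult.commute)
  finally show ?thesis by (simp add: lin_exp[OF lin_\<omega>(1)])
qed

lemma gD: "g (D x) y = g x (D y)"
  using D_self_adjoint by (simp add: g_def)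

lemma gD_sym: "g x (D y) = g y (D x)"
  by (metis gD g_sym)

lemma is_levi_civita_conn: "is_levi_civita br ip v w (conn v w)"
  unfolding is_levi_civita_def
proof
  fix u :: "real \<times> 'a"
  obtain a x where v: "v = (a, x)" by force
  obtain b y where w: "w = (b, y)" by force
  obtain t s where u: "u = (t, s)" by force
  show "2 * ip (conn v w) u = ip (br v w) u - ip (br w u) v + ip (br u v) w"
    using h_pos
    by (simp add: v w u conn_def semidirect_def ip_eq g_simps gJ field_simps)
      (simp add: gD gD_sym[of y s] gD_sym[of x s] gD_sym[of y x] g_sym[of z] skew[of s] skew[of y] algebra_simps)
qed

lemma bilinear_br: "bilinear br"
  unfolding bilinear_def semidirect_def
  by (intro conjI allI linearI)
    (auto simp: split_def \<omega>_simps linear_add[OF linD] linear_scale[OF linD] algebra_simps)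

lemma levi_civita_conn: "levi_civita br ip v w = conn v w"
  unfolding levi_civita_def
  using levi_civita_ex1[OF ip bilinear_br] is_levi_civita_conn by (intro the1_equality)

lemma linear_J: "linear J"
  unfolding J_def
  by (intro linear_compose_sum ballI linearI) (simp_all add: \<omega>_simps scaleR_add_left)

lemma bilinear_conn: "bilinear conn"
  unfolding bilinear_def conn_def
  by (intro conjI allI linearI)
    (simp_all add: \<omega>_simps g_simps linear_add[OF linD] linear_scale[OF linD] linear_add[OF linear_J]
        linear_scale[OF linear_J] algebra_simps add_divide_distrib)


text \<open>The trace of the curvature is taken over \<open>f\<close> and the frame
  \<open>X\<close>. Terms mixing \<open>a\<close> and \<open>x\<close> sum to zero because
  \<open>z\<close> is an eigenvector of \<open>D\<close> in the kernel of \<omega>; the contribution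
  of \<open>f\<close> cancels the term quadratic in \<open>D x\<close>.\<close>

lemma ricci_extension:
  "ricci br ip (a, x) (a, x) = - a\<^sup>2 * (\<Sum>j\<in>I. (c j)\<^sup>2) - (\<Sum>j\<in>I. c j) / h * g (D x) x
     - g z z / 2 * (\<Sum>j\<in>I. (\<omega> x (X j))\<^sup>2) + (g z x)\<^sup>2 / 4 * (\<Sum>i\<in>I. \<Sum>j\<in>I. (\<omega> (X i) (X j))\<^sup>2)"
proof -
  define v where "v = (a, x)"
  define R where "R u = riemann br ip u v v" for u
  have R: "R u = conn u (conn v v) - conn v (conn u v) - conn (br u v) v" for u
    by (simp add: R_def riemann_def levi_civita_conn)
  note conn_simps = bilinear_ladd[OF bilinear_conn] bilinear_radd[OF bilinear_conn]
    bilinear_lmul[OF bilinear_conn] bilinear_rmul[OF bilinear_conn]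
  note br_simps = bilinear_ladd[OF bilinear_br] bilinear_lmul[OF bilinear_br]
  have linR: "linear R"
    unfolding R by (intro linearI) (simp_all add: conn_simps br_simps algebra_simps)
  have linR': "linear (\<lambda>y. snd (R (0, y)))"
  proof -
    have "linear (\<lambda>y. (0::real, y::'a))" by (intro linearI) simp_all
    from linear_compose[OF this linear_compose[OF linR linear_snd]]
    show ?thesis by (simp add: o_def)
  qed
  define w where "w j = \<omega> x (X j)" for j
  define \<zeta> where "\<zeta> j = g z (X j)" for j
  define P where "P = (\<Sum>j\<in>I. (w j)\<^sup>2)"
  define q where "q k = (\<Sum>j\<in>I. \<omega> (X k) (X j) * w j)" for k
  define Q where "Q k = (\<Sum>j\<in>I. (\<omega> (X k) (X j))\<^sup>2)" for k
  define t where "t = g z x"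
  define \<eta> where "\<eta> = g z z"
  have Rf: "fst (R (1, 0)) = - g (D x) (D x) / h"
    by (simp add: R v_def conn_def semidirect_def \<omega>_simps g_simps linear_0[OF linD] linear_0[OF linear_J]
        linear_neg[OF linD] gD)
  have \<omega>J: "\<omega> y (J y') = (\<Sum>j\<in>I. \<omega> y' (X j) * \<omega> y (X j))" for y y'
    unfolding J_def by (simp add: linear_sum[OF lin_\<omega>(1)] \<omega>_simps)
  have \<omega>z': "\<omega> y z = 0" for y using skew[of y z] \<omega>z by simp
  have gzJ: "g z (J y) = 0" for y using gJ[of y z] \<omega>z' g_sym by simp
  have Jz: "J z = 0" by (simp add: J_def \<omega>z)
  have \<omega>self: "\<omega> y y = 0" for y using skew[of y y] by simp
  have \<omega>xJx: "\<omega> x (J x) = P" by (simp add: \<omega>J P_def w_def power2_eq_square)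
  \<comment> \<open>The three groups are the curvature terms \<open>conn u (conn v v)\<close>,
    \<open>conn v (conn u v)\<close> and \<open>conn (br u v) v\<close> at
    \<open>u = (0, X k)\<close>.\<close>
  have Rk: "g (snd (R (0, X k))) (X k) =
      (- c k * g (D x) x / h + \<zeta> k * \<omega> (X k) (- t *\<^sub>R J x - a *\<^sub>R D x))
      - (- \<zeta> k * \<zeta> k * P / 4 - t * \<zeta> k * q k / 2 - t * t * Q k / 4 + \<eta> * w k * w k / 4
          - c k * c k * (g x (X k) * g x (X k)) / h)
      - (a * a * c k * c k + 2 * a * (c k * (w k * \<zeta> k)) + \<eta> * w k * w k / 2)" if k: "k \<in> I" for k
  proof -
    have 1: "\<omega> (X k) x = - w k" by (simp add: w_def skew[of _ x])
    have 2: "g (D y) (X k) = c k * g y (X k)" for y by (simp add: gD DX[OF k] g_simps)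
    have 3: "g (X k) (X k) = 1" using X_unit[OF k] by (simp add: g_def)
    have 4: "\<omega> x (J (X k)) = q k" by (simp add: \<omega>J q_def w_def)
    have 5: "\<omega> (J x) (X k) = - q k"
      unfolding skew[of "J x"] by (simp add: \<omega>J q_def w_def mult.commute)
    have 6: "\<omega> (J (X k)) (X k) = - Q k"
      unfolding skew[of "J _"] by (simp add: \<omega>J Q_def power2_eq_square)
    have 9: "g (X k) x = g x (X k)" by (rule g_sym)
    note simps = conn_def semidirect_def \<omega>_simps g_simps \<omega>z \<omega>z' gzJ Jz \<omega>self gJ
      linear_add[OF linear_J] linear_diff[OF linear_J] linear_scale[OF linear_J] linear_neg[OF linear_J]
      DX[OF k] Dz 2 3 w_def[symmetric] \<zeta>_def[symmetric] t_def[symmetric] \<eta>_def[symmetric]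
    have a1: "g (snd (conn (0, X k) (b, y))) (X k) = - b * c k + \<zeta> k * \<omega> (X k) y" for b y
      by (simp add: simps 6 skew[of y])
    have a2: "conn v v = (g (D x) x / h, - t *\<^sub>R J x - a *\<^sub>R D x)"
      by (simp add: v_def simps algebra_simps, simp flip: scaleR_left_distrib)
    have a3: "conn (0, X k) v = (c k * g (X k) x / h,
       (1/2) *\<^sub>R (- w k *\<^sub>R z - \<zeta> k *\<^sub>R J x - t *\<^sub>R J (X k)) - (a * c k) *\<^sub>R X k)"
      by (simp add: v_def simps 1)
    have a4: "g (snd (conn v (b, y))) (X k) =
       (\<omega> x y * \<zeta> k - t * \<omega> y (X k) - g z y * w k) / 2 - b * (c k * g x (X k))" for b y
      by (simp add: v_def simps)
    have a5: "br (0, X k) v = (0, - (a * c k) *\<^sub>R X k - w k *\<^sub>R z)"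
      by (simp add: v_def simps 1)
    have a6: "g (snd (conn (0, y) v)) (X k) =
       (\<omega> y x * \<zeta> k - g z y * w k - t * \<omega> y (X k)) / 2 - a * (c k * g y (X k))" for y
      by (simp add: v_def simps)
    have "g (snd (R (0, X k))) (X k) =
      (- c k * g (D x) x / h + \<zeta> k * \<omega> (X k) (- t *\<^sub>R J x - a *\<^sub>R D x))
      - g (snd (conn v (conn (0, X k) v))) (X k) - g (snd (conn (br (0, X k) v) v)) (X k)"
      unfolding R by (simp add: g_simps(5) a1 a2)
    also have "g (snd (conn v (conn (0, X k) v))) (X k)
      = - \<zeta> k * \<zeta> k * P / 4 - t * \<zeta> k * q k / 2 - t * t * Q k / 4 + \<eta> * w k * w k / 4
          - c k * c k * (g x (X k) * g x (X k)) / h"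
      unfolding a3 a4
      by (simp add: \<omega>_simps g_simps 4 5 6 9 \<omega>z \<omega>z' gzJ \<omega>self \<omega>xJx w_def[symmetric]
        \<zeta>_def[symmetric] \<eta>_def[symmetric])
        (simp add: algebra_simps add_divide_distrib diff_divide_distrib)
    also have "g (snd (conn (br (0, X k) v) v)) (X k)
      = a * a * c k * c k + 2 * a * (c k * (w k * \<zeta> k)) + \<eta> * w k * w k / 2"
      unfolding a5 a6
      by (simp add: \<omega>_simps g_simps 1 3 \<omega>z \<omega>self \<zeta>_def[symmetric] \<eta>_def[symmetric])
        (simp add: algebra_simps add_divide_distrib diff_divide_distrib)
    finally show ?thesis .
  qed
  \<comment> \<open>The numbers \<open>\<zeta> k\<close> are the coefficients of \<open>z\<close>,
    so the sum evaluates \<omega> at \<open>z\<close>.\<close>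
  have "(\<Sum>k\<in>I. \<zeta> k * \<omega> (X k) y) = 0" for y
    unfolding \<zeta>_def lin_exp[OF lin_\<omega>(2)] by (rule \<omega>z)
  note s1 = this
  have s2: "(\<Sum>k\<in>I. \<zeta> k * \<zeta> k) = \<eta>"
    unfolding \<zeta>_def lin_exp[OF lin_g(1)] \<eta>_def ..
  have s3: "(\<Sum>k\<in>I. \<zeta> k * q k) = 0"
  proof -
    have "(\<Sum>k\<in>I. \<zeta> k * q k) = (\<Sum>k\<in>I. \<zeta> k * \<omega> (X k) (J x))"
      by (simp add: \<omega>J q_def w_def mult.commute)
    thus ?thesis by (simp add: s1)
  qed
  have s4: "(\<Sum>k\<in>I. c k * c k * (g x (X k) * g x (X k))) = g (D x) (D x)"
  proof -
    have "(\<Sum>k\<in>I. c k * c k * (g x (X k) * g x (X k))) = (\<Sum>k\<in>I. g (D x) (X k) * g (D x) (X k))"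
      by (intro sum.cong refl) (simp add: gD DX g_simps)
    thus ?thesis by (simp add: lin_exp[OF lin_g(1)])
  qed
  \<comment> \<open>Self-adjointness moves the factor \<open>c k\<close> onto \<open>z\<close>: the
    sum is \<open>\<omega> x (D z)\<close>, a multiple of \<open>\<omega> x z\<close>.\<close>
  have s5: "(\<Sum>k\<in>I. c k * (w k * \<zeta> k)) = 0"
  proof -
    have "(\<Sum>k\<in>I. c k * (w k * \<zeta> k)) = (\<Sum>k\<in>I. g (D z) (X k) * \<omega> x (X k))"
      by (intro sum.cong refl) (simp add: gD DX g_simps w_def \<zeta>_def)
    thus ?thesis by (simp add: lin_exp[OF lin_\<omega>(1)] Dz \<omega>_simps \<omega>z')
  qed
  have "ricci br ip v v = - g (D x) (D x) / h + (\<Sum>k\<in>I. g (snd (R (0, X k))) (X k))"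
    unfolding ricci_def R_def[symmetric] tr_prod Rf tr_expansion[OF bil_g linR' X_exp] ..
  also have "(\<Sum>k\<in>I. g (snd (R (0, X k))) (X k)) = (\<Sum>k\<in>I.
      - (g (D x) x / h) * c k + \<zeta> k * \<omega> (X k) (- t *\<^sub>R J x - a *\<^sub>R D x) + P / 4 * (\<zeta> k * \<zeta> k)
      + t / 2 * (\<zeta> k * q k) + t\<^sup>2 / 4 * Q k - 3 * \<eta> / 4 * (w k)\<^sup>2
      + (c k * c k * (g x (X k) * g x (X k))) / h
      - a\<^sup>2 * (c k)\<^sup>2 - 2 * a * (c k * (w k * \<zeta> k)))"
    by (intro sum.cong refl) (simp only: Rk, simp add: algebra_simps power2_eq_square)
  also have "\<dots> = - (g (D x) x / h) * (\<Sum>k\<in>I. c k) + P / 4 * \<eta> + t\<^sup>2 / 4 * (\<Sum>k\<in>I. Q k) - 3 * \<eta> / 4 * P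
      + g (D x) (D x) / h - a\<^sup>2 * (\<Sum>k\<in>I. (c k)\<^sup>2)"
    unfolding sum.distrib sum_subtractf sum_distrib_left[symmetric] sum_divide_distrib[symmetric]
      s1 s2 s3 s4 s5 P_def[symmetric] by simp
  finally show ?thesis
    by (simp add: v_def P_def w_def Q_def t_def \<eta>_def algebra_simps)
qed

end

section \<open>Self-adjoint diagonalisable operators\<close>

text \<open>Gram--Schmidt applied to an eigenbasis of a self-adjoint operator only combines vectors with the
  same eigenvalue, so it keeps the eigenvalues, and their indexing.\<close>
lemma orthonormal_eigenbasis:
  fixes g :: "'a::euclidean_space \<Rightarrow> 'a \<Rightarrow> real"
  assumes g: "bilinear g" and sym: "\<And>x y. g x y = g y x" and pos: "\<And>x. x \<noteq> 0 \<Longrightarrow> g x x > 0"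
    and D: "linear D" and adj: "\<And>x y. g (D x) y = g x (D y)"
    and eig: "\<And>b. b \<in> Basis \<Longrightarrow> D b = c b *\<^sub>R b"
  obtains X where "\<And>b. b \<in> Basis \<Longrightarrow> g (X b) (X b) = 1"
    and "\<And>b. b \<in> Basis \<Longrightarrow> D (X b) = c b *\<^sub>R X b"
    and "\<And>x. (\<Sum>b\<in>Basis. g x (X b) *\<^sub>R X b) = x"
proof -
  note g_simps = bilinear_ladd[OF g] bilinear_radd[OF g] bilinear_lmul[OF g] bilinear_rmul[OF g]
    bilinear_lsub[OF g] bilinear_rsub[OF g]
  have lin: "linear (\<lambda>x. g x y)" "linear (g y)" for y using g by (auto simp: bilinear_def)
  \<comment> \<open>Membership in \<open>span S\<close> ensures that the next basis vector differs
    from its projection. The expansion is demanded on \<open>S\<close> only and extends by linearity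
    once \<open>S\<close> is all of \<open>Basis\<close>.\<close>
  define ortho where "ortho S X \<longleftrightarrow> (\<forall>b\<in>S. X b \<in> span S \<and> D (X b) = c b *\<^sub>R X b) \<and>
      (\<forall>b\<in>S. \<forall>b'\<in>S. g (X b) (X b') = (if b = b' then 1 else 0)) \<and>
      (\<forall>x\<in>S. (\<Sum>b\<in>S. g x (X b) *\<^sub>R X b) = x)" for S X
  have ex: "finite S \<Longrightarrow> S \<subseteq> Basis \<Longrightarrow> \<exists>X. ortho S X" for S :: "'a set"
  proof (induction S rule: finite_induct)
    case empty
    show ?case by (simp add: ortho_def)
  next
    case (insert u S)
    then obtain X where "ortho S X" by auto
    hence X: "\<And>b. b \<in> S \<Longrightarrow> X b \<in> span S" "\<And>b. b \<in> S \<Longrightarrow> D (X b) = c b *\<^sub>R X b"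
      and orth: "\<And>b b'. b \<in> S \<Longrightarrow> b' \<in> S \<Longrightarrow> g (X b) (X b') = (if b = b' then 1 else 0)"
      and exp: "\<And>x. x \<in> S \<Longrightarrow> (\<Sum>b\<in>S. g x (X b) *\<^sub>R X b) = x"
      unfolding ortho_def by blast+
    have S: "finite S" "u \<notin> S" "u \<in> Basis" using insert by auto
    define p where "p = (\<Sum>b\<in>S. g u (X b) *\<^sub>R X b)"
    define y where "y = u - p"
    have "u \<notin> span S"
    proof
      assume "u \<in> span S"
      moreover have "S \<subseteq> Basis - {u}" using insert by auto
      ultimately have "u \<in> span (Basis - {u})" using span_mono by blast
      thus False using independent_Basis S(3) unfolding dependent_def by blast
    qed
    moreover have p: "p \<in> span S"
      unfolding p_def by (intro span_sum span_scale X(1))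
    ultimately have "y \<noteq> 0" by (auto simp: y_def)
    hence gy: "g y y > 0" by (rule pos)
    have yX: "g y (X b) = 0" if b: "b \<in> S" for b
    proof -
      have "g p (X b) = (\<Sum>b'\<in>S. if b' = b then g u (X b) else 0)"
        unfolding p_def linear_sum[OF lin(1)] by (intro sum.cong refl) (simp add: g_simps orth b)
      thus ?thesis using b S(1) by (simp add: y_def g_simps)
    qed
    have Dp: "D p = c u *\<^sub>R p"
      unfolding p_def linear_sum[OF D] scaleR_sum_right
    proof (intro sum.cong refl)
      fix b assume b: "b \<in> S"
      \<comment> \<open>So the coefficient vanishes unless both eigenvalues agree, and
        \<open>p\<close> belongs to the eigenvalue \<open>c u\<close>.\<close>
      have "c u * g u (X b) = c b * g u (X b)"
        using adj[of u "X b"] by (simp add: eig[OF S(3)] X(2)[OF b] g_simps)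
      thus "D (g u (X b) *\<^sub>R X b) = c u *\<^sub>R g u (X b) *\<^sub>R X b"
        by (auto simp: linear_scale[OF D] X(2)[OF b])
    qed
    have Dy: "D y = c u *\<^sub>R y"
      by (simp add: y_def linear_diff[OF D] eig[OF S(3)] Dp algebra_simps)
    define X' where "X' = X(u := (1 / sqrt (g y y)) *\<^sub>R y)"
    have X'u: "X' u = (1 / sqrt (g y y)) *\<^sub>R y" by (simp add: X'_def)
    have X'S: "X' b = X b" if "b \<in> S" for b using that S(2) by (auto simp: X'_def)
    have sq: "sqrt (g y y) * sqrt (g y y) = g y y" using gy by simp
    have X'uu: "g (X' u) (X' u) = 1" using gy by (simp add: X'u g_simps sq)
    have X'uS: "g (X' u) (X b) = 0" if "b \<in> S" for b using yX[OF that] by (simp add: X'u g_simps)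
    have gyp: "g y p = 0"
      unfolding p_def linear_sum[OF lin(2)] by (rule sum.neutral) (simp add: g_simps yX)
    have guy: "g u y = g y y"
    proof -
      have "u = y + p" by (simp add: y_def)
      hence "g u y = g y y + g p y" by (metis g_simps(1))
      thus ?thesis using gyp sym by simp
    qed
    have exp_u: "g u (X' u) *\<^sub>R X' u + (\<Sum>b\<in>S. g u (X b) *\<^sub>R X b) = u"
    proof -
      have "g u (X' u) *\<^sub>R X' u = y" using gy by (simp add: X'u g_simps guy sq)
      thus ?thesis by (simp add: y_def p_def)
    qed
    \<comment> \<open>The earlier vectors expand in the earlier frame, which is orthogonal to the
      new vector; hence their expansions stay valid.\<close>
    have exp_S: "g x (X' u) = 0" if x: "x \<in> S" for x
    proof -
      have "g x (X' u) = (\<Sum>b\<in>S. g (g x (X b) *\<^sub>R X b) (X' u))"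
        by (subst exp[OF x, symmetric]) (rule linear_sum[OF lin(1)])
      also have "\<dots> = 0"
        using X'uS sym by (intro sum.neutral) (simp add: g_simps)
      finally show ?thesis .
    qed
    have sp: "span S \<subseteq> span (insert u S)" by (rule span_mono) auto
    show ?case
      unfolding ortho_def
    proof (intro exI[of _ X'] conjI ballI)
      fix b assume b: "b \<in> insert u S"
      have "y \<in> span (insert u S)"
        unfolding y_def using p sp by (intro span_diff) (auto intro: span_base)
      thus "X' b \<in> span (insert u S)"
        using b X(1) sp X'S by (cases "b = u") (auto simp: X'u intro: span_scale)
      show "D (X' b) = c b *\<^sub>R X' b"
        using b X(2) X'S by (cases "b = u") (auto simp: X'u linear_scale[OF D] Dy)
    next
      fix b b' assume "b \<in> insert u S" "b' \<in> insert u S"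
      thus "g (X' b) (X' b') = (if b = b' then 1 else 0)"
        using X'uu X'uS orth X'S S(2) sym by auto
    next
      fix x assume x: "x \<in> insert u S"
      have "(\<Sum>b\<in>insert u S. g x (X' b) *\<^sub>R X' b) = g x (X' u) *\<^sub>R X' u + (\<Sum>b\<in>S. g x (X b) *\<^sub>R X b)"
        using S X'S by simp
      thus "(\<Sum>b\<in>insert u S. g x (X' b) *\<^sub>R X' b) = x"
        using x exp_u exp exp_S by auto
    qed
  qed
  obtain X :: "'a \<Rightarrow> 'a" where "ortho Basis X" using ex[OF finite_Basis order_refl] ..
  hence X: "\<And>b. b \<in> Basis \<Longrightarrow> D (X b) = c b *\<^sub>R X b"
      "\<And>b. b \<in> Basis \<Longrightarrow> g (X b) (X b) = 1"
      "\<And>x. x \<in> Basis \<Longrightarrow> (\<Sum>b\<in>Basis. g x (X b) *\<^sub>R X b) = x"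
    unfolding ortho_def by simp_all
  have "(\<Sum>b\<in>Basis. g x (X b) *\<^sub>R X b) = x" for x
  proof -
    have "linear (\<lambda>x. \<Sum>b\<in>Basis. g x (X b) *\<^sub>R X b)"
      by (intro linear_compose_sum ballI linearI) (simp_all add: g_simps scaleR_add_left)
    moreover have "linear (\<lambda>x::'a. x)" by (rule linear_ident)
    ultimately show ?thesis by (rule linear_eq_stdbasis[THEN fun_cong]) (rule X(3))
  qed
  thus thesis using that X by blast
qed

section \<open>Operators diagonal in the fixed basis, given by weights\<close>

definition diag_op :: "('a::euclidean_space \<Rightarrow> real) \<Rightarrow> 'a \<Rightarrow> 'a" where
  "diag_op w x = (\<Sum>b\<in>Basis. (w b * (x \<bullet> b)) *\<^sub>R b)"

lemma linear_diag_op: "linear (diag_op w)"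
  unfolding diag_op_def
  by (intro linear_compose_sum ballI linearI) (simp_all add: inner_add_left algebra_simps)

lemma diag_op_inner_Basis: "b \<in> Basis \<Longrightarrow> diag_op w x \<bullet> b = w b * (x \<bullet> b)"
  by (simp add: diag_op_def)

lemma diag_op_inner: "diag_op w x \<bullet> y = (\<Sum>b\<in>Basis. w b * (x \<bullet> b) * (y \<bullet> b))"
  by (subst euclidean_inner) (simp add: diag_op_inner_Basis)

lemma diag_op_Basis: "b \<in> Basis \<Longrightarrow> diag_op w b = w b *\<^sub>R b"
  by (rule euclidean_eqI) (simp add: diag_op_inner_Basis inner_Basis)

lemma diag_op_self_adjoint: "diag_op w x \<bullet> y = x \<bullet> diag_op w y"
  by (simp add: inner_commute[of x "diag_op w y"] diag_op_inner mult_ac)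

lemma diag_op_inner_self_pos:
  assumes "\<And>b. b \<in> Basis \<Longrightarrow> w b > 0" and "x \<noteq> 0"
  shows "diag_op w x \<bullet> x > 0"
proof -
  obtain b where b: "b \<in> Basis" "x \<bullet> b \<noteq> 0"
    using \<open>x \<noteq> 0\<close> euclidean_all_zero_iff by blast
  show ?thesis
    unfolding diag_op_inner
  proof (rule sum_pos2[OF finite_Basis b(1)])
    show "0 < w b * (x \<bullet> b) * (x \<bullet> b)" using assms(1)[OF b(1)] b(2)
      by (simp add: mult.assoc zero_less_mult_iff less_le)
    show "0 \<le> w i * (x \<bullet> i) * (x \<bullet> i)" if "i \<in> Basis" for i
      using assms(1)[OF that] by (simp add: mult.assoc)
  qed
qed

lemma linear_eq_diag_op:
  assumes "linear A" "\<And>b. b \<in> Basis \<Longrightarrow> A b = w b *\<^sub>R b"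
  shows "A = diag_op w"
  using linear_eq_stdbasis[OF assms(1) linear_diag_op] by (simp add: assms(2) diag_op_Basis)

lemma diag_op_compose: "diag_op v (diag_op w x) = diag_op (\<lambda>b. v b * w b) x"
  by (rule euclidean_eqI) (simp add: diag_op_inner_Basis)

lemma diag_op_one: "diag_op (\<lambda>b. 1) = id"
  by (rule ext, rule euclidean_eqI) (simp add: diag_op_inner_Basis)

lemma diag_op_cong: "(\<And>b. b \<in> Basis \<Longrightarrow> v b = w b) \<Longrightarrow> diag_op v = diag_op w"
  by (rule ext, rule euclidean_eqI) (simp add: diag_op_inner_Basis)

lemma tr_diag_op: "tr (diag_op w) = (\<Sum>b\<in>Basis. w b)"
  unfolding tr_def by (intro sum.cong refl) (simp add: diag_op_inner_Basis)

lemma diag_op_inverse: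
  assumes "\<And>b. b \<in> Basis \<Longrightarrow> w b \<noteq> 0"
  shows "bij (diag_op w)" and "inv (diag_op w) = diag_op (\<lambda>b. 1 / w b)"
proof -
  have *: "diag_op w \<circ> diag_op (\<lambda>b. 1 / w b) = id" "diag_op (\<lambda>b. 1 / w b) \<circ> diag_op w = id"
    unfolding diag_op_one[symmetric] o_def diag_op_compose by (auto intro!: diag_op_cong simp: assms)
  show "bij (diag_op w)" using * by (rule o_bij[rotated])
  show "inv (diag_op w) = diag_op (\<lambda>b. 1 / w b)" using *(2,1) by (rule inv_unique_comp[rotated])
qed

lemma inner_gl_diag_op: "inner_gl (diag_op w) A = (\<Sum>b\<in>Basis. w b * (A b \<bullet> b))"
  unfolding inner_gl_def by (intro sum.cong refl) (simp add: diag_op_Basis inner_commute)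

section \<open>The Heisenberg algebra\<close>

locale heisenberg_basis =
  fixes n :: nat and e :: "nat \<Rightarrow> 'a::euclidean_space"
  assumes n: "n \<ge> 1" and e: "bij_betw e {1..2*n+1} Basis"
begin

section \<open>The Darboux basis of the Heisenberg algebra\<close>

definition N :: "nat set" where "N = {1..n}"
definition p :: "nat \<Rightarrow> 'a" where "p i = e (2*i-1)"
definition q :: "nat \<Rightarrow> 'a" where "q i = e (2*i)"
definition z :: 'a where "z = e (2*n+1)"

lemma finite_N [simp]: "finite N" and card_N [simp]: "card N = n"
  by (simp_all add: N_def)

lemma e_mem: "i \<in> {1..2*n+1} \<Longrightarrow> e i \<in> Basis"
  using e by (rule bij_betwE[THEN bspec])

lemma Basis_mem: "i \<in> N \<Longrightarrow> p i \<in> Basis" "i \<in> N \<Longrightarrow> q i \<in> Basis" "z \<in> Basis"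
  unfolding p_def q_def z_def by (rule e_mem, auto simp: N_def)+

lemma e_eq_iff: "i \<in> {1..2*n+1} \<Longrightarrow> j \<in> {1..2*n+1} \<Longrightarrow> e i = e j \<longleftrightarrow> i = j"
  using e by (auto simp: bij_betw_def inj_on_def)

lemma Basis_neq: "i \<in> N \<Longrightarrow> j \<in> N \<Longrightarrow> p i = p j \<longleftrightarrow> i = j"
  "i \<in> N \<Longrightarrow> j \<in> N \<Longrightarrow> q i = q j \<longleftrightarrow> i = j"
  "i \<in> N \<Longrightarrow> j \<in> N \<Longrightarrow> p i \<noteq> q j"
  "i \<in> N \<Longrightarrow> p i \<noteq> z" "i \<in> N \<Longrightarrow> q i \<noteq> z"
proof -
  show "p i = p j \<longleftrightarrow> i = j" if "i \<in> N" "j \<in> N"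
    unfolding p_def using that by (subst e_eq_iff) (auto simp: N_def)
  show "q i = q j \<longleftrightarrow> i = j" if "i \<in> N" "j \<in> N"
    unfolding q_def using that by (subst e_eq_iff) (auto simp: N_def)
  show "p i \<noteq> q j" if "i \<in> N" "j \<in> N"
    unfolding p_def q_def using that by (subst e_eq_iff) (auto simp: N_def, presburger)
  show "p i \<noteq> z" if "i \<in> N"
    unfolding p_def z_def using that by (subst e_eq_iff) (auto simp: N_def)
  show "q i \<noteq> z" if "i \<in> N"
    unfolding q_def z_def using that by (subst e_eq_iff) (auto simp: N_def)
qed

lemma Basis_inner: "i \<in> N \<Longrightarrow> j \<in> N \<Longrightarrow> p i \<bullet> p j = (if i = j then 1 else 0)"
  "i \<in> N \<Longrightarrow> j \<in> N \<Longrightarrow> q i \<bullet> q j = (if i = j then 1 else 0)"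
  "i \<in> N \<Longrightarrow> j \<in> N \<Longrightarrow> p i \<bullet> q j = 0"
  "i \<in> N \<Longrightarrow> j \<in> N \<Longrightarrow> q i \<bullet> p j = 0"
  "i \<in> N \<Longrightarrow> p i \<bullet> z = 0" "i \<in> N \<Longrightarrow> z \<bullet> p i = 0"
  "i \<in> N \<Longrightarrow> q i \<bullet> z = 0" "i \<in> N \<Longrightarrow> z \<bullet> q i = 0"
  "z \<bullet> z = 1"
proof -
  show "p i \<bullet> p j = (if i = j then 1 else 0)" "q i \<bullet> q j = (if i = j then 1 else 0)"
    "p i \<bullet> q j = 0" "q i \<bullet> p j = 0" if "i \<in> N" "j \<in> N"
    using that Basis_neq(3)[OF that(2,1), symmetric] by (simp_all add: inner_Basis Basis_mem Basis_neq)
  show "p i \<bullet> z = 0" "z \<bullet> p i = 0" "q i \<bullet> z = 0" "z \<bullet> q i = 0" if "i \<in> N"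
    using Basis_neq(4,5)[OF that] Basis_mem that by (auto simp: inner_Basis)
  show "z \<bullet> z = 1" using Basis_mem(3) by simp
qed

lemma sum_Basis: "(\<Sum>b\<in>Basis. f b) = (\<Sum>i\<in>N. f (p i) + f (q i)) + f z"
  for f :: "'a \<Rightarrow> 'c::comm_monoid_add"
proof -
  have "(\<Sum>k=1..2*m. f (e k)) = (\<Sum>i=1..m. f (p i) + f (q i))" for m
    by (induction m) (simp_all add: p_def q_def add.assoc)
  moreover have "(\<Sum>b\<in>Basis. f b) = (\<Sum>k=1..2*n+1. f (e k))"
    using sum.reindex_bij_betw[OF e, of f] by simp
  ultimately show ?thesis by (simp add: z_def N_def)
qed

lemma Basis_cases:
  assumes "b \<in> Basis"
  obtains i where "i \<in> N" "b = p i" | i where "i \<in> N" "b = q i" | "b = z"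
proof -
  obtain k where k: "k \<in> {1..2*n+1}" "b = e k" using assms e unfolding bij_betw_def by blast
  show thesis
    using k(1) by (cases rule: heisenberg_index_cases) (use k(2) that in \<open>auto simp: p_def q_def z_def N_def\<close>)
qed

text \<open>Weights can be prescribed freely on the basis without inverting the enumeration
  \<open>e\<close>: by orthonormality, pairing with the basis vectors singles out the wanted
  value.\<close>

lemma ex_weight:
  obtains w :: "'a \<Rightarrow> real" where "\<And>i. i \<in> N \<Longrightarrow> w (p i) = f i" "\<And>i. i \<in> N \<Longrightarrow> w (q i) = g i"
    "w z = c"
proof
  let ?w = "\<lambda>b. (\<Sum>j\<in>N. f j * (p j \<bullet> b) + g j * (q j \<bullet> b)) + c * (z \<bullet> b)"
  show "?w (p i) = f i" "?w (q i) = g i" if "i \<in> N" for i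
    using that by (simp_all add: Basis_inner if_distrib[of "(*) _"] cong: sum.cong if_cong)
  show "?w z = c" by (simp add: Basis_inner)
qed

section \<open>Brackets with rescaled structure constants\<close>

definition hform :: "(nat \<Rightarrow> real) \<Rightarrow> 'a \<Rightarrow> 'a \<Rightarrow> real" where
  "hform a x y = (\<Sum>i\<in>N. a i * ((x \<bullet> p i) * (y \<bullet> q i) - (x \<bullet> q i) * (y \<bullet> p i)))"

text \<open>These brackets contain the whole orbit closure; zero entries of \<open>a\<close> account
  for degenerate limits.\<close>

definition hbracket :: "(nat \<Rightarrow> real) \<Rightarrow> 'a bracket" where
  "hbracket a = (\<lambda>x y. hform a x y *\<^sub>R z)"

lemma heisenberg_eq_hbracket: "heisenberg n e = hbracket (\<lambda>i. 1)"
  by (simp add: heisenberg_def hbracket_def hform_def p_def q_def z_def N_def)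

lemma bilinear_hform: "bilinear (hform a)"
  unfolding bilinear_def hform_def
  by (intro conjI allI linearI) (simp_all add: inner_add_left algebra_simps sum.distrib
        sum_subtractf sum_distrib_left)

lemma bilinear_hbracket: "bilinear (hbracket a)"
  using bilinear_hform[of a] by (simp add: bilinear_def hbracket_def linear_iff scaleR_add_left)

lemma hform_skew: "hform a x y = - hform a y x"
  unfolding hform_def sum_negf[symmetric] by (intro sum.cong refl) (simp add: algebra_simps)

lemma hform_Basis: "i \<in> N \<Longrightarrow> hform a (p i) x = a i * (x \<bullet> q i)"
  "i \<in> N \<Longrightarrow> hform a (q i) x = - a i * (x \<bullet> p i)" "hform a z x = 0"
  "i \<in> N \<Longrightarrow> hform a x (p i) = - a i * (x \<bullet> q i)"
  "i \<in> N \<Longrightarrow> hform a x (q i) = a i * (x \<bullet> p i)" "hform a x z = 0"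
proof -
  show 1: "hform a (p i) x = a i * (x \<bullet> q i)" "hform a (q i) x = - a i * (x \<bullet> p i)" if "i \<in> N" for i
    unfolding hform_def using that by (simp_all add: Basis_inner if_distrib if_distribR cong: sum.cong if_cong)
  show 2: "hform a z x = 0" unfolding hform_def by (simp add: Basis_inner)
  show "hform a x (p i) = - a i * (x \<bullet> q i)" "hform a x (q i) = a i * (x \<bullet> p i)" if "i \<in> N"
    unfolding hform_skew[of a x] using 1 that by simp_all
  show "hform a x z = 0" unfolding hform_skew[of a x] using 2 by simp
qed

section \<open>The torus in terms of weights, and the condition shared by both sides\<close>

definition graded :: "('a \<Rightarrow> real) \<Rightarrow> bool" where
  "graded w \<longleftrightarrow> (\<forall>i\<in>N. w (p i) + w (q i) = w z)"

lemma diag_op_mem_torus: "diag_op w \<in> heisenberg_torus n e \<longleftrightarrow> graded w"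
proof
  assume "diag_op w \<in> heisenberg_torus n e"
  then obtain d where d: "\<forall>i\<in>N. diag_op w (p i) = d i *\<^sub>R p i \<and> diag_op w (q i) = (d (n+1) - d i) *\<^sub>R q i"
    "diag_op w z = d (n+1) *\<^sub>R z"
    unfolding heisenberg_torus_def p_def q_def z_def N_def by blast
  have nz: "b \<noteq> 0" if "b \<in> Basis" for b :: 'a using that by auto
  have "w z = d (n+1)" using d(2) nz[OF Basis_mem(3)] by (simp add: diag_op_Basis Basis_mem)
  moreover have "w (p i) = d i" "w (q i) = d (n+1) - d i" if "i \<in> N" for i
    using d(1) that nz[OF Basis_mem(1)] nz[OF Basis_mem(2)] by (simp_all add: diag_op_Basis Basis_mem)
  ultimately show "graded w" by (simp add: graded_def)
next
  assume w: "graded w"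
  show "diag_op w \<in> heisenberg_torus n e"
    unfolding heisenberg_torus_def N_def[symmetric]
  \<comment> \<open>In the parametrisation of the torus, index \<open>n+1\<close> belongs to the
    centre and the indices up to \<open>n\<close> to the \<open>p i\<close>.\<close>
  proof (intro CollectI conjI linear_diag_op exI[of _ "\<lambda>i. if i = n+1 then w z else w (p i)"] ballI)
    fix i assume i: "i \<in> N"
    hence "i \<noteq> n + 1" by (simp add: N_def)
    thus "diag_op w (e (2*i-1)) = (if i = n+1 then w z else w (p i)) *\<^sub>R e (2*i-1)"
      using diag_op_Basis[OF Basis_mem(1)[OF i], of w] by (simp add: p_def)
    have "w (q i) = w z - w (p i)" using w i by (auto simp: graded_def)
    thus "diag_op w (e (2*i)) = ((if n+1 = n+1 then w z else w (p (n+1))) -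
          (if i = n+1 then w z else w (p i))) *\<^sub>R e (2*i)"
      using diag_op_Basis[OF Basis_mem(2)[OF i], of w] \<open>i \<noteq> n + 1\<close> by (simp add: q_def)
  qed (use diag_op_Basis[OF Basis_mem(3), of w] in \<open>simp add: z_def\<close>)
qed

lemma torus_cases:
  assumes "D \<in> heisenberg_torus n e"
  obtains w where "D = diag_op w" "graded w"
proof -
  have "D \<in> Diag" using assms heisenberg_torus_eq_Diag_derivations[OF n e] by blast
  hence "linear D" "\<forall>b\<in>Basis. \<exists>d. D b = d *\<^sub>R b" by (auto simp: Diag_def)
  then obtain w where "D = diag_op w" using linear_eq_diag_op by metis
  thus thesis using that assms diag_op_mem_torus by blast
qed

text \<open>Every Darboux pair contributes \<open>w z\<close>, so a positive trace amounts to a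
  positive eigenvalue at the centre.\<close>

lemma tr_graded:
  assumes "graded w"
  shows "tr (diag_op w) = (real n + 1) * w z"
proof -
  have "(\<Sum>i\<in>N. w (p i) + w (q i)) = (\<Sum>i\<in>N. w z)"
    using assms by (intro sum.cong refl) (simp add: graded_def)
  thus ?thesis by (simp add: tr_diag_op sum_Basis algebra_simps)
qed

text \<open>The weak inequalities admit \<open>\<beta> i = 0\<close>, which arises from the zero
  bracket in the orbit closure and from pairs without negative eigenvalue.\<close>

definition admissible :: "('a \<Rightarrow> real) \<Rightarrow> (nat \<Rightarrow> real) \<Rightarrow> bool" where
  "admissible w \<beta> \<longleftrightarrow> (\<forall>i\<in>N. 0 \<le> \<beta> i \<and> 0 \<le> w (p i) + \<beta> i \<and> 0 \<le> w (q i) + \<beta> i) \<and>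
     (\<Sum>i\<in>N. \<beta> i) < w z"

lemma admissible_strict:
  assumes "admissible w \<beta>"
  obtains \<gamma> where "\<And>i. i \<in> N \<Longrightarrow> 0 < \<gamma> i" "\<And>i. i \<in> N \<Longrightarrow> 0 < w (p i) + \<gamma> i"
    "\<And>i. i \<in> N \<Longrightarrow> 0 < w (q i) + \<gamma> i" "(\<Sum>i\<in>N. \<gamma> i) < w z"
proof
  \<comment> \<open>Dividing the slack by \<open>n + 1\<close> instead of \<open>n\<close> leaves
    one \<epsilon> over after all \<open>n\<close> terms have grown.\<close>
  define \<epsilon> where "\<epsilon> = (w z - (\<Sum>i\<in>N. \<beta> i)) / (real n + 1)"
  have \<epsilon>: "\<epsilon> > 0" using assms by (simp add: \<epsilon>_def admissible_def)
  let ?\<gamma> = "\<lambda>i. \<beta> i + \<epsilon>"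
  show "0 < ?\<gamma> i" "0 < w (p i) + ?\<gamma> i" "0 < w (q i) + ?\<gamma> i" if "i \<in> N" for i
    using assms \<epsilon> that by (force simp: admissible_def)+
  have "(real n + 1) * \<epsilon> = w z - (\<Sum>i\<in>N. \<beta> i)" by (simp add: \<epsilon>_def)
  hence "(\<Sum>i\<in>N. ?\<gamma> i) = w z - \<epsilon>" by (simp add: sum.distrib algebra_simps)
  thus "(\<Sum>i\<in>N. ?\<gamma> i) < w z" using \<epsilon> by simp
qed

subsection \<open>Strongly Ricci negative derivations\<close>

abbreviation \<omega> :: "'a \<Rightarrow> 'a \<Rightarrow> real" where "\<omega> \<equiv> hform (\<lambda>i. 1)"

text \<open>The derivation property read off at the coefficient of \<open>z\<close>. It makes
  \<omega> vanish on two eigenvectors whose eigenvalues do not add up to \<open>w z\<close>.\<close>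

lemma graded_hform:
  assumes "graded w"
  shows "\<omega> (diag_op w x) y + \<omega> x (diag_op w y) = w z * \<omega> x y"
  unfolding hform_def sum_distrib_left sum.distrib[symmetric]
proof (intro sum.cong refl)
  fix i assume i: "i \<in> N"
  have "w z = w (p i) + w (q i)" using assms i by (simp add: graded_def)
  thus "1 * ((diag_op w x \<bullet> p i) * (y \<bullet> q i) - (diag_op w x \<bullet> q i) * (y \<bullet> p i)) +
      1 * ((x \<bullet> p i) * (diag_op w y \<bullet> q i) - (x \<bullet> q i) * (diag_op w y \<bullet> p i))
    = w z * (1 * ((x \<bullet> p i) * (y \<bullet> q i) - (x \<bullet> q i) * (y \<bullet> p i)))"
    using i by (simp add: diag_op_inner_Basis Basis_mem algebra_simps)
qed

text \<open>\<open>\<omega>\<close> vanishes on the sum \<open>W\<close> of the eigenspaces of \<open>D\<close> with negative eigenvalue, because the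
  eigenvalue of \<open>D\<close> at the centre is positive. Hence in the trace of the quadratic form \<open>|\<omega>(x, \<cdot>)|\<^sup>2\<close>
  over \<open>W\<close>, which bounds the negative eigenvalues, only pairs from \<open>W \<times> W\<^sup>\<bottom>\<close> occur, and each of
  them occurs twice in \<open>|\<omega>|\<^sup>2\<close>, which is bounded by the eigenvalue at the centre.\<close>
lemma srn_imp_admissible:
  assumes w: "graded w" and srn: "strongly_ricci_negative (heisenberg n e) (diag_op w)"
  obtains \<beta> where "admissible w \<beta>"
proof -
  let ?D = "diag_op w"
  obtain ip where ip: "inner_product ip"
    and adj: "\<And>x y. ip (0, ?D x) (0, y) = ip (0, x) (0, ?D y)"
    and ip_f: "\<And>x. ip (1, 0) (0, x) = 0"
    and neg: "\<And>v. v \<noteq> 0 \<Longrightarrow> ricci (semidirect (heisenberg n e) ?D) ip v v < 0"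
    using srn unfolding strongly_ricci_negative_def by blast
  have tr: "tr ?D > 0" using srn by (simp add: strongly_ricci_negative_def)
  have wz: "w z > 0" using tr tr_graded[OF w] by (simp add: zero_less_mult_iff)
  define g where "g x y = ip (0, x) (0, y)" for x y
  have bil: "bilinear g" using bilinear_restrict_snd[OF ip] by (simp add: g_def[abs_def])
  have sym: "g x y = g y x" for x y
    using ip unfolding inner_product_def g_def by blast
  have pos: "g x x > 0" if "x \<noteq> 0" for x
    using ip that unfolding inner_product_def g_def by (simp add: zero_prod_def)
  obtain X where X: "\<And>b. b \<in> Basis \<Longrightarrow> g (X b) (X b) = 1"
      "\<And>b. b \<in> Basis \<Longrightarrow> ?D (X b) = w b *\<^sub>R X b"
      "\<And>x. (\<Sum>b\<in>Basis. g x (X b) *\<^sub>R X b) = x"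
    using orthonormal_eigenbasis[OF bil sym pos linear_diag_op adj[folded g_def] diag_op_Basis] by metis
  interpret E: metric_extension ip ?D \<omega> z Basis X w "w z"
    by unfold_locales
      (fact ip ip_f adj hform_skew X(2) linear_add[OF linear_diag_op] linear_scale[OF linear_diag_op]
        bilinear_hform hform_Basis(3) X(3)[unfolded g_def]
        X(1)[unfolded g_def] diag_op_Basis[OF Basis_mem(3)])+
  have g: "E.g = g" by (simp add: fun_eq_iff E.g_def g_def)
  define s where "s = (\<Sum>b\<in>Basis. w b) / E.h"
  have s: "s > 0" using tr E.h_pos by (simp add: s_def tr_diag_op)
  define \<eta> where "\<eta> = g z z"
  have z0: "z \<noteq> 0" using Basis_mem(3) by auto
  have \<eta>: "\<eta> > 0" using pos[OF z0] by (simp add: \<eta>_def)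
  have ric: "ricci (semidirect (heisenberg n e) ?D) ip (0, x) (0, x) = - s * g (?D x) x
     - \<eta> / 2 * (\<Sum>b\<in>Basis. (\<omega> x (X b))\<^sup>2) + (g z x)\<^sup>2 / 4 * (\<Sum>b\<in>Basis. \<Sum>b'\<in>Basis. (\<omega> (X b) (X b'))\<^sup>2)" for x
    using E.ricci_extension[of 0 x] by (simp add: heisenberg_eq_hbracket hbracket_def g s_def \<eta>_def)
  define Q where "Q b b' = (\<omega> (X b) (X b'))\<^sup>2" for b b'
  define m where "m b = max 0 (- w b)" for b
  \<comment> \<open>\<open>F\<close> keeps the pairs with the first vector in \<open>W\<close> and
    the second in its orthogonal complement, while \<open>m\<close> is the negative part of the
    eigenvalues.\<close>
  define F where "F b b' = (if w b < 0 \<and> \<not> w b' < 0 then Q b b' else 0)" for b b'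
  note g_simps = bilinear_lmul[OF bil] bilinear_rmul[OF bil]
  have Q0: "Q b b' = 0" if b: "b \<in> Basis" "b' \<in> Basis" and neg: "w b < 0" "w b' < 0" for b b'
  proof -
    have "w z * \<omega> (X b) (X b') = (w b + w b') * \<omega> (X b) (X b')"
      using graded_hform[OF w, of "X b" "X b'"]
      by (simp add: X(2) b bilinear_lmul[OF bilinear_hform] bilinear_rmul[OF bilinear_hform] algebra_simps)
    moreover have "w z \<noteq> w b + w b'" using neg wz by linarith
    ultimately show ?thesis by (simp add: Q_def)
  qed
  have m: "s * m b \<le> \<eta> / 2 * (\<Sum>b'\<in>Basis. F b b')" if b: "b \<in> Basis" for b
  proof (cases "w b < 0")
    case True
    \<comment> \<open>Eigenvectors for distinct eigenvalues are orthogonal, so the positive term of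
      the Ricci formula is absent at \<open>X b\<close>.\<close>
    have "w z * g z (X b) = w b * g z (X b)"
      using adj[of z "X b"] b by (simp add: g_def[symmetric] X(2) diag_op_Basis Basis_mem g_simps)
    hence gz: "g z (X b) = 0" using True wz by auto
    have "X b \<noteq> 0" using X(1)[OF b] by (auto simp: bilinear_lzero[OF bil])
    hence "- s * w b - \<eta> / 2 * (\<Sum>b'\<in>Basis. Q b b') < 0"
      using neg[of "(0, X b)"] b by (simp add: ric gz X g_simps zero_prod_def Q_def)
    also have "(\<Sum>b'\<in>Basis. Q b b') = (\<Sum>b'\<in>Basis. F b b')"
      using True Q0[OF b] by (intro sum.cong refl) (auto simp: F_def)
    finally show ?thesis using True by (simp add: m_def)
  next
    case False
    thus ?thesis by (simp add: m_def F_def)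
  qed
  have "s * (\<Sum>b\<in>Basis. m b) \<le> \<eta> / 2 * (\<Sum>b\<in>Basis. \<Sum>b'\<in>Basis. F b b')"
    unfolding sum_distrib_left[of s] sum_distrib_left[of "\<eta> / 2"]
    using m by (intro sum_mono) (simp add: sum_distrib_left)
  also have "\<dots> = \<eta> / 4 * (\<Sum>b\<in>Basis. \<Sum>b'\<in>Basis. F b b' + F b' b)"
    unfolding sum.distrib by (subst (3) sum.swap) simp
  \<comment> \<open>The conditions in \<open>F b b'\<close> and \<open>F b' b\<close> exclude each
    other, so at most one summand is nonzero. This is where the factor 1/2 is gained.\<close>
  also have "\<dots> \<le> \<eta> / 4 * (\<Sum>b\<in>Basis. \<Sum>b'\<in>Basis. Q b b')"
  proof (intro mult_left_mono sum_mono)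
    fix b b' :: 'a
    have "Q b b' = Q b' b" unfolding Q_def by (subst hform_skew) simp
    moreover have "Q b b' \<ge> 0" by (simp add: Q_def)
    ultimately show "F b b' + F b' b \<le> Q b b'" by (simp add: F_def)
  qed (use \<eta> in simp)
  also have "\<dots> < s * w z"
  proof -
    \<comment> \<open>At \<open>z\<close> the bracket contributes positively, so negative curvature
      there bounds the full sum of \<open>Q\<close>.\<close>
    have "- s * (w z * \<eta>) + \<eta>\<^sup>2 / 4 * (\<Sum>b\<in>Basis. \<Sum>b'\<in>Basis. Q b b') < 0"
      using neg[of "(0, z)"] z0
      by (simp add: ric hform_Basis diag_op_Basis Basis_mem g_simps \<eta>_def[symmetric] zero_prod_def Q_def)
    hence "\<eta> * (\<eta> / 4 * (\<Sum>b\<in>Basis. \<Sum>b'\<in>Basis. Q b b')) < \<eta> * (s * w z)"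
      by (simp add: power2_eq_square algebra_simps)
    thus ?thesis using \<eta> by simp
  qed
  finally have "(\<Sum>b\<in>Basis. m b) < w z" using s by simp
  hence "(\<Sum>i\<in>N. m (p i) + m (q i)) < w z"
    using wz by (simp add: sum_Basis m_def)
  hence "admissible w (\<lambda>i. m (p i) + m (q i))"
    by (auto simp: admissible_def m_def)
  thus thesis by (rule that)
qed

text \<open>A metric diagonal in the fixed basis suffices: rescaling the \<open>p i\<close> alone
  realises the positive numbers \<gamma> in the Ricci operator of the nilradical.\<close>

lemma admissible_imp_srn:
  assumes w: "graded w" and "admissible w \<beta>"
  shows "strongly_ricci_negative (heisenberg n e) (diag_op w)"
proof -
  obtain \<gamma> where \<gamma>: "\<And>i. i \<in> N \<Longrightarrow> 0 < \<gamma> i" "\<And>i. i \<in> N \<Longrightarrow> 0 < w (p i) + \<gamma> i"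
    "\<And>i. i \<in> N \<Longrightarrow> 0 < w (q i) + \<gamma> i" "(\<Sum>i\<in>N. \<gamma> i) < w z"
    using admissible_strict[OF assms(2)] by blast
  have "0 \<le> (\<Sum>i\<in>N. \<gamma> i)" by (intro sum_nonneg less_imp_le \<gamma>(1))
  hence wz: "w z > 0" using \<gamma>(4) by linarith
  define T where "T = (\<Sum>b\<in>Basis. w b)"
  have T: "T > 0" using tr_graded[OF w] wz by (simp add: T_def tr_diag_op)
  \<comment> \<open>With \<open>|e\<^sub>2\<^sub>i\<^sub>-\<^sub>1|\<^sup>2 = 1 / A\<^sub>i\<close> and all other basis vectors of length \<open>1\<close>, the operator \<open>Ric\<^sub>\<nn>\<close> is
    \<open>Diag(-A\<^sub>1, -A\<^sub>1, \<dots>, \<Sum>A\<^sub>i) / 2\<close>, that is \<open>T Diag(-\<gamma>\<^sub>1, -\<gamma>\<^sub>1, \<dots>, \<Sum>\<gamma>\<^sub>i)\<close>.\<close>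
  define A where "A i = 2 * T * \<gamma> i" for i
  have A: "A i > 0" if "i \<in> N" for i using \<gamma>(1)[OF that] T by (simp add: A_def)
  have sumA: "(\<Sum>i\<in>N. A i) = 2 * T * (\<Sum>i\<in>N. \<gamma> i)" by (simp add: A_def sum_distrib_left)
  obtain u where u: "\<And>i. i \<in> N \<Longrightarrow> u (p i) = 1 / A i" "\<And>i. i \<in> N \<Longrightarrow> u (q i) = 1" "u z = 1"
    using ex_weight[of "\<lambda>i. 1 / A i" "\<lambda>i. 1" 1] by blast
  have upos: "u b > 0" if "b \<in> Basis" for b
    using that by (cases rule: Basis_cases) (auto simp: u A)
  define ip where "ip v v' = fst v * fst v' + diag_op u (snd v) \<bullet> snd v'" for v v' :: "real \<times> 'a"
  define X where "X b = (1 / sqrt (u b)) *\<^sub>R b" for b :: 'a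
  have sq: "sqrt (u b) * sqrt (u b) = u b" if "b \<in> Basis" for b using upos[OF that] by simp
  have ip: "inner_product ip"
    unfolding inner_product_def bilinear_def
  proof (intro conjI allI impI)
    fix v v' :: "real \<times> 'a"
    show "linear (ip v)" "linear (\<lambda>v'. ip v' v)"
      unfolding ip_def by (intro linearI; simp add: linear_add[OF linear_diag_op] linear_scale[OF linear_diag_op]
          inner_add_left inner_add_right algebra_simps)+
    show "ip v v' = ip v' v"
      unfolding ip_def using diag_op_self_adjoint[of u "snd v" "snd v'"] by (simp add: inner_commute mult.commute)
    show "ip v v > 0" if "v \<noteq> 0"
    proof (cases "snd v = 0")
      case True
      hence "fst v \<noteq> 0" using that by (metis prod.collapse zero_prod_def)
      thus ?thesis using True by (simp add: ip_def) (metis not_real_square_gt_zero)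
    next
      case False
      hence "diag_op u (snd v) \<bullet> snd v > 0" by (intro diag_op_inner_self_pos upos)
      thus ?thesis by (simp add: ip_def add_nonneg_pos)
    qed
  qed
  have adj: "ip (0, diag_op w x) (0, y) = ip (0, x) (0, diag_op w y)" for x y
  proof -
    have "diag_op u (diag_op w x) \<bullet> y = diag_op w (diag_op u x) \<bullet> y" by (simp add: diag_op_compose mult.commute)
    thus ?thesis by (simp add: ip_def diag_op_self_adjoint[of w])
  qed
  have X_unit: "ip (0, X b) (0, X b) = 1" if "b \<in> Basis" for b
    using that upos[OF that] sq[OF that] by (simp add: ip_def X_def linear_scale[OF linear_diag_op] diag_op_Basis)
  have X_exp: "(\<Sum>b\<in>Basis. ip (0, x) (0, X b) *\<^sub>R X b) = x" for x
  proof -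
    have "(\<Sum>b\<in>Basis. ip (0, x) (0, X b) *\<^sub>R X b) = (\<Sum>b\<in>Basis. (x \<bullet> b) *\<^sub>R b)"
      using upos sq by (intro sum.cong refl) (simp add: ip_def X_def diag_op_inner_Basis, metis less_irrefl)
    thus ?thesis by (simp add: euclidean_representation)
  qed
  have X_eig: "diag_op w (X b) = w b *\<^sub>R X b" if "b \<in> Basis" for b
    using that by (simp add: X_def linear_scale[OF linear_diag_op] diag_op_Basis)
  have ip_f: "ip (1, 0) (0, x) = 0" for x
    by (simp add: ip_def linear_0[OF linear_diag_op])
  interpret E: metric_extension ip "diag_op w" \<omega> z Basis X w "w z"
    by unfold_locales
      (fact ip ip_f adj X_unit X_exp X_eig hform_skew linear_add[OF linear_diag_op]
        linear_scale[OF linear_diag_op] bilinear_hform hform_Basis(3)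
        diag_op_Basis[OF Basis_mem(3)])+
  have h: "E.h = 1" by (simp add: E.h_def ip_def)
  have gz: "E.g z x = x \<bullet> z" for x
    by (simp add: E.g_def ip_def diag_op_Basis Basis_mem u inner_commute)
  have \<omega>X: "(\<Sum>b\<in>Basis. (\<omega> x (X b))\<^sup>2) = (\<Sum>i\<in>N. A i * (x \<bullet> q i)\<^sup>2 + (x \<bullet> p i)\<^sup>2)" for x
  proof -
    have "(\<omega> x (X b))\<^sup>2 = (\<omega> x b)\<^sup>2 / u b" if "b \<in> Basis" for b
      using upos[OF that] by (simp add: X_def bilinear_rmul[OF bilinear_hform] power_divide)
    hence "(\<Sum>b\<in>Basis. (\<omega> x (X b))\<^sup>2) = (\<Sum>b\<in>Basis. (\<omega> x b)\<^sup>2 / u b)" by simp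
    also have "\<dots> = (\<Sum>i\<in>N. A i * (x \<bullet> q i)\<^sup>2 + (x \<bullet> p i)\<^sup>2)"
      by (simp add: sum_Basis hform_Basis u mult.commute)
    finally show ?thesis .
  qed
  have \<omega>XX: "(\<Sum>b\<in>Basis. \<Sum>b'\<in>Basis. (\<omega> (X b) (X b'))\<^sup>2) = 2 * (\<Sum>i\<in>N. A i)"
  proof -
    have "(\<Sum>b\<in>Basis. \<Sum>b'\<in>Basis. (\<omega> (X b) (X b'))\<^sup>2)
        = (\<Sum>b\<in>Basis. (\<Sum>i\<in>N. A i * (b \<bullet> q i)\<^sup>2 + (b \<bullet> p i)\<^sup>2) / u b)"
    proof (intro sum.cong refl)
      fix b :: 'a assume b: "b \<in> Basis"
      show "(\<Sum>b'\<in>Basis. (\<omega> (X b) (X b'))\<^sup>2) = (\<Sum>i\<in>N. A i * (b \<bullet> q i)\<^sup>2 + (b \<bullet> p i)\<^sup>2) / u b"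
        unfolding \<omega>X sum_divide_distrib using upos[OF b]
        by (intro sum.cong refl) (simp add: X_def power_divide add_divide_distrib)
    qed
    also have "\<dots> = (\<Sum>i\<in>N. A i + A i)"
      by (simp add: sum_Basis u Basis_inner if_distrib[of "\<lambda>x. x ^ 2"] if_distrib[of "(*) _"]
          cong: sum.cong if_cong)
    finally show ?thesis by (simp add: sum_distrib_left)
  qed
  \<comment> \<open>The weights of \<open>- Ric\<close> on the nilradical as a quadratic form in
    standard coordinates, hence the division by \<open>A i\<close> at \<open>p i\<close>. With
    \<open>A i = 2 * T * \<gamma> i\<close> they become positive multiples of
    \<open>w (p i) + \<gamma> i\<close>, \<open>w (q i) + \<gamma> i\<close> and \<open>w z\<close>
    minus the sum of \<gamma>.\<close>
  obtain \<kappa> where \<kappa>: "\<And>i. i \<in> N \<Longrightarrow> \<kappa> (p i) = T * w (p i) / A i + 1 / 2"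
    "\<And>i. i \<in> N \<Longrightarrow> \<kappa> (q i) = T * w (q i) + A i / 2" "\<kappa> z = T * w z - (\<Sum>i\<in>N. A i) / 2"
    using ex_weight[of "\<lambda>i. T * w (p i) / A i + 1 / 2" "\<lambda>i. T * w (q i) + A i / 2"] by blast
  have \<kappa>pos: "\<kappa> b > 0" if "b \<in> Basis" for b
    using that
  proof (cases rule: Basis_cases)
    case (1 i)
    have "\<kappa> b = T * (w (p i) + \<gamma> i) / A i"
      using 1 A[OF 1(1)] T \<gamma>(1)[OF 1(1)] by (simp add: \<kappa> field_simps) (simp add: A_def)
    thus ?thesis using \<gamma>(2)[OF 1(1)] A[OF 1(1)] T by simp
  next
    case (2 i)
    have "\<kappa> b = T * (w (q i) + \<gamma> i)" using 2 by (simp add: \<kappa> A_def algebra_simps)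
    thus ?thesis using \<gamma>(3)[OF 2(1)] T by simp
  next
    case 3
    have "\<kappa> b = T * (w z - (\<Sum>i\<in>N. \<gamma> i))"
      using 3 by (simp add: \<kappa> sumA algebra_simps)
    thus ?thesis using \<gamma>(4) T by simp
  qed
  have ric: "ricci (semidirect (heisenberg n e) (diag_op w)) ip (a, x) (a, x)
      = - (a\<^sup>2 * (\<Sum>b\<in>Basis. (w b)\<^sup>2) + diag_op \<kappa> x \<bullet> x)" for a x
  proof -
    have "T * E.g (diag_op w x) x = (\<Sum>b\<in>Basis. T * u b * w b * (x \<bullet> b)\<^sup>2)"
      by (simp add: E.g_def ip_def diag_op_compose diag_op_inner power2_eq_square mult.assoc sum_distrib_left)
    also have "\<dots> = (\<Sum>i\<in>N. (\<kappa> (p i) - 1 / 2) * (x \<bullet> p i)\<^sup>2 + (\<kappa> (q i) - A i / 2) * (x \<bullet> q i)\<^sup>2)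
        + (\<kappa> z + (\<Sum>i\<in>N. A i) / 2) * (x \<bullet> z)\<^sup>2"
      by (simp add: sum_Basis u \<kappa>)
    also have "\<dots> = (\<Sum>b\<in>Basis. \<kappa> b * (x \<bullet> b)\<^sup>2) - (\<Sum>i\<in>N. A i * (x \<bullet> q i)\<^sup>2 + (x \<bullet> p i)\<^sup>2) / 2
        + (\<Sum>i\<in>N. A i) / 2 * (x \<bullet> z)\<^sup>2"
      by (simp add: sum_Basis algebra_simps sum.distrib sum_subtractf sum_divide_distrib add_divide_distrib)
    also have "(\<Sum>b\<in>Basis. \<kappa> b * (x \<bullet> b)\<^sup>2) = diag_op \<kappa> x \<bullet> x"
      by (simp add: diag_op_inner power2_eq_square mult.assoc)
    finally show ?thesis
      using E.ricci_extension[of a x]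
      unfolding heisenberg_eq_hbracket hbracket_def \<omega>XX \<omega>X[of x] gz h T_def[symmetric]
      by (simp add: Basis_inner)
  qed
  have "ricci (semidirect (heisenberg n e) (diag_op w)) ip v v < 0" if v: "v \<noteq> 0" for v
  proof -
    obtain a x where v': "v = (a, x)" by force
    \<comment> \<open>The entry \<open>w z\<close> alone makes the trace of the square of
      \<open>D\<close> positive, which settles the direction \<open>f\<close>.\<close>
    have w2: "(\<Sum>b\<in>Basis. (w b)\<^sup>2) > 0"
      using wz by (intro sum_pos2[OF finite_Basis Basis_mem(3)]) auto
    show ?thesis
    proof (cases "x = 0")
      case True
      hence "a \<noteq> 0" using v v' by (auto simp: zero_prod_def)
      thus ?thesis using w2 True by (simp add: v' ric)
    next
      case False
      hence "diag_op \<kappa> x \<bullet> x > 0" by (intro diag_op_inner_self_pos \<kappa>pos)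
      moreover have "a\<^sup>2 * (\<Sum>b\<in>Basis. (w b)\<^sup>2) \<ge> 0" using w2 by simp
      ultimately show ?thesis unfolding v' ric by linarith
    qed
  qed
  moreover have "derivation (heisenberg n e) (diag_op w)"
    using w diag_op_mem_torus heisenberg_torus_eq_Diag_derivations[OF n e] by blast
  ultimately show ?thesis
    unfolding strongly_ricci_negative_def using ip adj T
    by (intro conjI exI[of _ ip]) (auto simp: tr_diag_op T_def ip_def linear_0[OF linear_diag_op])
qed

subsection \<open>The cone\<close>

lemma sum_Basis_hform:
  "(\<Sum>b\<in>Basis. \<Sum>c\<in>Basis. hform a b c * f b c) = (\<Sum>i\<in>N. a i * (f (p i) (q i) - f (q i) (p i)))"
proof -
  have \<delta>: "(\<Sum>c\<in>Basis. (c \<bullet> b) * k c) = k b" if "b \<in> Basis" for b :: 'a and k :: "'a \<Rightarrow> real"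
  proof -
    have "(\<Sum>c\<in>Basis. (c \<bullet> b) * k c) = (\<Sum>c\<in>Basis. if c = b then k b else 0)"
      using that by (intro sum.cong refl) (simp add: inner_Basis)
    thus ?thesis using that by simp
  qed
  have "(\<Sum>c\<in>Basis. hform a (p i) c * f (p i) c) = a i * f (p i) (q i)"
    "(\<Sum>c\<in>Basis. hform a (q i) c * f (q i) c) = - a i * f (q i) (p i)"
    if "i \<in> N" for i
    using that \<delta>[of "q i" "f (p i)"] \<delta>[of "p i" "f (q i)"]
    by (simp_all add: hform_Basis Basis_mem mult.assoc sum_distrib_left[symmetric] sum_negf)
  thus ?thesis
    by (subst sum_Basis) (simp add: hform_Basis algebra_simps)
qed

lemma inner_bracket_hbracket:
  "inner_bracket \<nu> (hbracket a) = 1/2 * (\<Sum>i\<in>N. a i * (\<nu> (p i) (q i) \<bullet> z - \<nu> (q i) (p i) \<bullet> z))"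
  using sum_Basis_hform[of a "\<lambda>b c. \<nu> b c \<bullet> z"] by (simp add: inner_bracket_def hbracket_def)

text \<open>Only diagonal entries of \<open>E\<close> survive, which is why the moment map of
  \<open>hbracket a\<close> is diagonal.\<close>

lemma inner_bracket_gl_der_hbracket:
  assumes "linear E"
  shows "inner_bracket (gl_der E (hbracket a)) (hbracket a)
    = (\<Sum>i\<in>N. (a i)\<^sup>2 * (E z \<bullet> z - E (p i) \<bullet> p i - E (q i) \<bullet> q i))"
  unfolding inner_bracket_hbracket sum_distrib_left
proof (intro sum.cong refl)
  fix i assume i: "i \<in> N"
  show "1/2 * (a i * (gl_der E (hbracket a) (p i) (q i) \<bullet> z - gl_der E (hbracket a) (q i) (p i) \<bullet> z))
      = (a i)\<^sup>2 * (E z \<bullet> z - E (p i) \<bullet> p i - E (q i) \<bullet> q i)"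
    using i by (simp add: gl_der_def hbracket_def hform_Basis Basis_inner linear_scale[OF assms] inner_diff_left
        algebra_simps power2_eq_square)
qed

lemma norm_hbracket: "inner_bracket (hbracket a) (hbracket a) = (\<Sum>i\<in>N. (a i)\<^sup>2)"
  unfolding inner_bracket_hbracket sum_distrib_left
  by (intro sum.cong refl) (simp add: hbracket_def hform_Basis Basis_inner power2_eq_square)

text \<open>Moments are unique, so it is enough that the diagonal candidate satisfies the defining
  identity. The entry at \<open>z\<close> is 1 because it is the sum of squares divided by
  itself.\<close>

lemma moment_map_hbracket:
  assumes s: "(\<Sum>i\<in>N. (a i)\<^sup>2) > 0"
    and m: "\<And>i. i \<in> N \<Longrightarrow> m (p i) = - (a i)\<^sup>2 / (\<Sum>i\<in>N. (a i)\<^sup>2)"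
      "\<And>i. i \<in> N \<Longrightarrow> m (q i) = - (a i)\<^sup>2 / (\<Sum>i\<in>N. (a i)\<^sup>2)" "m z = 1"
  shows "moment_map (hbracket a) = diag_op m"
proof (rule is_moment_unique)
  let ?s = "\<Sum>i\<in>N. (a i)\<^sup>2"
  have "hbracket a \<noteq> (\<lambda>x y. 0)"
  proof
    assume "hbracket a = (\<lambda>x y. 0)"
    hence "inner_bracket (hbracket a) (hbracket a) = 0" by (simp add: inner_bracket_def)
    thus False using s by (simp add: norm_hbracket)
  qed
  with bilinear_hbracket show "is_moment (hbracket a) (moment_map (hbracket a))" by (rule moment_map_works)
  show "is_moment (hbracket a) (diag_op m)"
    unfolding is_moment_def
  proof (intro conjI ballI)
    show "diag_op m \<in> sym_op" by (simp add: sym_op_def linear_diag_op diag_op_self_adjoint)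
    fix E :: "'a \<Rightarrow> 'a" assume "E \<in> sym_op"
    hence E: "linear E" by (simp add: sym_op_def)
    have "?s * inner_gl (diag_op m) E =
        (\<Sum>i\<in>N. (?s * m (p i)) * (E (p i) \<bullet> p i) + (?s * m (q i)) * (E (q i) \<bullet> q i)) + ?s * (E z \<bullet> z)"
      by (simp add: inner_gl_diag_op sum_Basis m(3) distrib_left sum_distrib_left mult.assoc)
    also have "\<dots> = (\<Sum>i\<in>N. (- (a i)\<^sup>2) * (E (p i) \<bullet> p i) + (- (a i)\<^sup>2) * (E (q i) \<bullet> q i)) + ?s * (E z \<bullet> z)"
    proof -
      have "?s * m (p i) = - (a i)\<^sup>2" "?s * m (q i) = - (a i)\<^sup>2" if "i \<in> N" for i
        using s that m(1,2) by simp_all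
      thus ?thesis by simp
    qed
    also have "\<dots> = inner_bracket (gl_der E (hbracket a)) (hbracket a)"
      unfolding inner_bracket_gl_der_hbracket[OF E] sum_distrib_right sum.distrib[symmetric]
      by (intro sum.cong refl) (simp add: algebra_simps)
    finally show "inner_gl (diag_op m) E =
        1 / inner_bracket (hbracket a) (hbracket a) * inner_bracket (gl_der E (hbracket a)) (hbracket a)"
      using s by (simp add: norm_hbracket field_simps)
  qed
qed

section \<open>The orbit and its closure\<close>

lemma gl_act_diag_op:
  assumes "\<And>b. b \<in> Basis \<Longrightarrow> v b \<noteq> 0"
  shows "gl_act (diag_op v) (heisenberg n e) = hbracket (\<lambda>i. v z / (v (p i) * v (q i)))"
proof -
  have "hform (\<lambda>i. 1) (diag_op (\<lambda>b. 1 / v b) x) (diag_op (\<lambda>b. 1 / v b) y) * v z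
      = hform (\<lambda>i. v z / (v (p i) * v (q i))) x y" for x y
    unfolding hform_def sum_distrib_right
    by (intro sum.cong refl) (simp add: diag_op_inner_Basis Basis_mem right_diff_distrib
        left_diff_distrib diff_divide_distrib mult_ac)
  thus ?thesis
    by (simp add: gl_act_def diag_op_inverse(2)[OF assms] heisenberg_eq_hbracket hbracket_def
        linear_scale[OF linear_diag_op]
        diag_op_Basis Basis_mem)
qed

text \<open>Commuting with one torus element that has simple spectrum already forces an operator to
  be diagonal.\<close>

lemma centralizer_torus:
  assumes "h \<in> centralizer_GL (heisenberg_torus n e)"
  obtains v where "h = diag_op v" "\<And>b. b \<in> Basis \<Longrightarrow> v b \<noteq> 0"
proof -
  have h: "linear h" "bij h" "\<And>D x. D \<in> heisenberg_torus n e \<Longrightarrow> h (D x) = D (h x)"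
    using assms by (auto simp: centralizer_GL_def fun_eq_iff)
  \<comment> \<open>The values \<open>- i\<close>, \<open>1 + i\<close> for \<open>i \<ge> 1\<close>
    and \<open>1\<close> are pairwise distinct, and each pair adds up to
    \<open>w z = 1\<close>.\<close>
  obtain w :: "'a \<Rightarrow> real" where w: "\<And>i. i \<in> N \<Longrightarrow> w (p i) = - real i"
    "\<And>i. i \<in> N \<Longrightarrow> w (q i) = 1 + real i" "w z = 1"
    using ex_weight[of "\<lambda>i. - real i" "\<lambda>i. 1 + real i" 1] by blast
  have inj: "b = b'" if "b \<in> Basis" "b' \<in> Basis" "w b = w b'" for b b'
    using that by (elim Basis_cases) (auto simp: w N_def)
  have "diag_op w \<in> heisenberg_torus n e" by (simp add: diag_op_mem_torus graded_def w)
  note comm = h(3)[OF this]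
  have hb: "h b = (h b \<bullet> b) *\<^sub>R b" if b: "b \<in> Basis" for b
  proof (rule euclidean_eqI)
    fix b' :: 'a assume b': "b' \<in> Basis"
    have "w b * (h b \<bullet> b') = w b' * (h b \<bullet> b')"
      using arg_cong[OF comm[of b], of "\<lambda>x. x \<bullet> b'"] b b'
      by (simp add: diag_op_Basis linear_scale[OF h(1)] diag_op_inner_Basis)
    thus "h b \<bullet> b' = (h b \<bullet> b) *\<^sub>R b \<bullet> b'"
      using inj[OF b b'] b b' by (auto simp: inner_Basis)
  qed
  have hv: "h = diag_op (\<lambda>b. h b \<bullet> b)" by (rule linear_eq_diag_op[OF h(1) hb])
  have "h b \<bullet> b \<noteq> 0" if b: "b \<in> Basis" for b
  proof
    assume "h b \<bullet> b = 0"
    hence "h b = h 0" using hb[OF b] linear_0[OF h(1)] by simp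
    hence "b = 0" using h(2) by (simp add: bij_def inj_eq)
    thus False using b by simp
  qed
  with hv show thesis by (rule that)
qed

text \<open>The straight segment from the identity stays among diagonal operators with positive
  entries, hence inside the centralizer.\<close>

lemma diag_op_mem_G_torus:
  assumes v: "\<And>b. b \<in> Basis \<Longrightarrow> v b > 0"
  shows "diag_op v \<in> G_torus (heisenberg_torus n e)"
proof -
  let ?f = "\<lambda>t b. (1 - t) + t * v b"
  have cont: "continuous_on {0..1::real} (\<lambda>t. diag_op (?f t))"
    unfolding diag_op_def by (intro continuous_on_coordinatewise_then_product continuous_intros)
  have "diag_op (?f t) \<in> centralizer_GL (heisenberg_torus n e)" if t: "t \<in> {0..1}" for t
  proof -
    have "?f t b \<noteq> 0" if b: "b \<in> Basis" for b
    proof (cases "t = 0")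
      case False
      hence "t * v b > 0" using t v[OF b] by simp
      thus ?thesis using t by (smt (verit) atLeastAtMost_iff)
    qed simp
    hence "bij (diag_op (?f t))" by (rule diag_op_inverse)
    moreover have "diag_op (?f t) \<circ> D = D \<circ> diag_op (?f t)" if "D \<in> heisenberg_torus n e" for D
      using that by (elim torus_cases) (simp add: fun_eq_iff diag_op_compose mult.commute)
    ultimately show ?thesis by (simp add: centralizer_GL_def linear_diag_op)
  qed
  hence "(\<lambda>t. diag_op (?f t)) ` {0..1} \<subseteq> centralizer_GL (heisenberg_torus n e)" by blast
  moreover have "connected ((\<lambda>t. diag_op (?f t)) ` {0..1})"
    using cont by (rule connected_continuous_image) simp
  moreover have "id \<in> (\<lambda>t. diag_op (?f t)) ` {0..1}" by (rule image_eqI[of _ _ 0]) (simp_all add: diag_op_one)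
  moreover have "diag_op v \<in> (\<lambda>t. diag_op (?f t)) ` {0..1}" by (rule image_eqI[of _ _ 1]) simp_all
  ultimately show ?thesis
    unfolding G_torus_def by (auto simp: connected_component_def)
qed

lemma orbit_closure:
  assumes "\<nu> \<in> closure ((\<lambda>h. gl_act h (heisenberg n e)) ` G_torus (heisenberg_torus n e))"
  obtains a where "\<nu> = hbracket a"
proof -
  \<comment> \<open>Reading the coefficients off \<nu> itself replaces the existence of
    \<open>a\<close> by equations between continuous functions of \<nu>, so \<open>S\<close> is
    closed.\<close>
  define S where "S = {\<nu>. \<forall>x y. \<nu> x y = hbracket (\<lambda>i. \<nu> (p i) (q i) \<bullet> z) x y}"
  have coord: "continuous_on UNIV (\<lambda>\<nu> :: 'a bracket. \<nu> x y)" for x y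
    by (rule continuous_on_product_then_coordinatewise[OF continuous_on_product_coordinates])
  have "continuous_on UNIV (\<lambda>\<nu> :: 'a bracket. hbracket (\<lambda>i. \<nu> (p i) (q i) \<bullet> z) x y)" for x y
    unfolding hbracket_def hform_def
    by (rule continuous_on_scaleR[OF continuous_on_sum[OF continuous_on_mult[OF
        continuous_on_inner[OF coord continuous_on_const] continuous_on_const]] continuous_on_const])
  hence "closed {\<nu> :: 'a bracket. \<nu> x y = hbracket (\<lambda>i. \<nu> (p i) (q i) \<bullet> z) x y}" for x y
    by (rule closed_Collect_eq[OF coord])
  hence "closed S"
    unfolding S_def by (rule closed_Collect_all[OF closed_Collect_all])
  moreover have "(\<lambda>h. gl_act h (heisenberg n e)) ` G_torus (heisenberg_torus n e) \<subseteq> S"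
  proof (intro image_subsetI)
    fix h assume "h \<in> G_torus (heisenberg_torus n e)"
    hence "h \<in> centralizer_GL (heisenberg_torus n e)"
      unfolding G_torus_def using connected_component_subset by blast
    then obtain v where v: "h = diag_op v" "\<And>b. b \<in> Basis \<Longrightarrow> v b \<noteq> 0" by (metis centralizer_torus)
    have "gl_act h (heisenberg n e) = hbracket (\<lambda>i. v z / (v (p i) * v (q i)))"
      unfolding v(1) by (rule gl_act_diag_op) (rule v(2))
    moreover have "hbracket a \<in> S" for a
    proof -
      have "hbracket a (p i) (q i) \<bullet> z = a i" if "i \<in> N" for i
        using that by (simp add: hbracket_def hform_Basis Basis_inner)
      hence "hform (\<lambda>i. hbracket a (p i) (q i) \<bullet> z) x y = hform a x y" for x y
        unfolding hform_def by (intro sum.cong refl) simp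
      thus ?thesis unfolding S_def by (simp add: hbracket_def)
    qed
    ultimately show "gl_act h (heisenberg n e) \<in> S" by simp
  qed
  ultimately have "\<nu> \<in> S" using assms closure_minimal by blast
  thus thesis unfolding S_def using that by blast
qed

lemma cone_imp_admissible:
  assumes "diag_op w \<in> cone_C (heisenberg n e) (heisenberg_torus n e)"
  obtains \<beta> where "admissible w \<beta>"
proof -
  obtain r \<nu> E where r: "r > 0"
    and \<nu>: "\<nu> \<in> closure ((\<lambda>h. gl_act h (heisenberg n e)) ` G_torus (heisenberg_torus n e))"
    and E: "E \<in> Diag_pos" and D: "diag_op w = (\<lambda>x. r *\<^sub>R moment_map \<nu> x + E x)"
    using assms unfolding cone_C_def by blast
  obtain a where a: "\<nu> = hbracket a" using \<nu> by (rule orbit_closure)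
  have Epos: "E b \<bullet> b > 0" if "b \<in> Basis" for b
    using E that by (auto simp: Diag_pos_def)
  have w: "w b = r * (moment_map \<nu> b \<bullet> b) + E b \<bullet> b" if "b \<in> Basis" for b
    using arg_cong[OF fun_cong[OF D, of b], of "\<lambda>x. x \<bullet> b"] that
    by (simp add: diag_op_inner_Basis inner_add_left)
  define s where "s = (\<Sum>i\<in>N. (a i)\<^sup>2)"
  have "s \<ge> 0" unfolding s_def by (intro sum_nonneg) simp
  then consider "s = 0" | "s > 0" by linarith
  thus thesis
  proof cases
    \<comment> \<open>The limit is the zero bracket. By the convention for its moment map,
      \<open>D\<close> itself is positive.\<close>
    case 1
    hence "a i = 0" if "i \<in> N" for i
      using that by (simp add: s_def sum_nonneg_eq_0_iff)
    hence "moment_map \<nu> = (\<lambda>x. 0)"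
      by (simp add: a hbracket_def hform_def moment_map_def)
    hence "w b > 0" if "b \<in> Basis" for b using w[OF that] Epos[OF that] by simp
    hence "admissible w (\<lambda>i. 0)" by (simp add: admissible_def Basis_mem less_imp_le)
    thus thesis by (rule that)
  next
    case 2
    obtain m where m: "\<And>i. i \<in> N \<Longrightarrow> m (p i) = - (a i)\<^sup>2 / s"
      "\<And>i. i \<in> N \<Longrightarrow> m (q i) = - (a i)\<^sup>2 / s" "m z = 1"
      using ex_weight[of "\<lambda>i. - (a i)\<^sup>2 / s" "\<lambda>i. - (a i)\<^sup>2 / s" 1] by blast
    have mm: "moment_map \<nu> = diag_op m"
      unfolding a by (rule moment_map_hbracket) (use 2 m in \<open>simp_all add: s_def\<close>)
    have w': "w b > r * m b" if "b \<in> Basis" for b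
      using w[OF that] Epos[OF that] that by (simp add: mm diag_op_inner_Basis)
    \<comment> \<open>These are the numbers \<beta>; their sum \<open>r\<close> lies below
      \<open>w z\<close> by positivity of \<open>E\<close> at \<open>z\<close>, where the moment map
      has entry 1.\<close>
    have "(\<Sum>i\<in>N. r * (a i)\<^sup>2 / s) = r"
      using 2 by (simp add: sum_divide_distrib[symmetric] sum_distrib_left[symmetric] s_def[symmetric])
    moreover have "0 \<le> w (p i) + r * (a i)\<^sup>2 / s" "0 \<le> w (q i) + r * (a i)\<^sup>2 / s" if "i \<in> N" for i
      using w'[OF Basis_mem(1)] w'[OF Basis_mem(2)] that by (force simp: m)+
    ultimately have "admissible w (\<lambda>i. r * (a i)\<^sup>2 / s)"
      using r 2 w'[OF Basis_mem(3)] by (simp add: admissible_def m(3))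
    thus thesis by (rule that)
  qed
qed

lemma admissible_imp_cone:
  assumes w: "graded w" and "admissible w \<beta>"
  shows "diag_op w \<in> cone_C (heisenberg n e) (heisenberg_torus n e)"
proof -
  obtain \<gamma> where \<gamma>: "\<And>i. i \<in> N \<Longrightarrow> 0 < \<gamma> i" "\<And>i. i \<in> N \<Longrightarrow> 0 < w (p i) + \<gamma> i"
    "\<And>i. i \<in> N \<Longrightarrow> 0 < w (q i) + \<gamma> i" "(\<Sum>i\<in>N. \<gamma> i) < w z"
    using admissible_strict[OF assms(2)] by blast
  define r where "r = (\<Sum>i\<in>N. \<gamma> i)"
  have r: "r > 0" unfolding r_def
  proof (rule sum_pos)
    show "N \<noteq> {}" using n by (auto simp: N_def)
  qed (use \<gamma>(1) in auto)
  \<comment> \<open>Chosen so that the coefficient \<open>v z / (v (p i) * v (q i))\<close> is the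
    square root of \<open>\<gamma> i\<close>. The bracket then lies in the orbit itself.\<close>
  obtain v where v: "\<And>i. i \<in> N \<Longrightarrow> v (p i) = 1 / sqrt (\<gamma> i)" "\<And>i. i \<in> N \<Longrightarrow> v (q i) = 1" "v z = 1"
    using ex_weight[of "\<lambda>i. 1 / sqrt (\<gamma> i)" "\<lambda>i. 1" 1] by blast
  have vpos: "v b > 0" if "b \<in> Basis" for b
    using that by (cases rule: Basis_cases) (auto simp: v \<gamma>)
  define a where "a i = v z / (v (p i) * v (q i))" for i
  have a: "(a i)\<^sup>2 = \<gamma> i" if "i \<in> N" for i
    using \<gamma>(1)[OF that] that by (simp add: a_def v)
  have "hbracket a = gl_act (diag_op v) (heisenberg n e)"
    unfolding a_def by (rule gl_act_diag_op[symmetric]) (metis vpos less_irrefl)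
  hence orbit: "hbracket a \<in> closure ((\<lambda>h. gl_act h (heisenberg n e)) ` G_torus (heisenberg_torus n e))"
    by (simp only:) (intro closure_subset[THEN subsetD] imageI diag_op_mem_G_torus vpos)
  have s: "(\<Sum>i\<in>N. (a i)\<^sup>2) = r" using a by (simp add: r_def)
  obtain m where m: "\<And>i. i \<in> N \<Longrightarrow> m (p i) = - (a i)\<^sup>2 / r"
      "\<And>i. i \<in> N \<Longrightarrow> m (q i) = - (a i)\<^sup>2 / r" "m z = 1"
    using ex_weight[of "\<lambda>i. - (a i)\<^sup>2 / r" "\<lambda>i. - (a i)\<^sup>2 / r" 1] by blast
  have mm: "moment_map (hbracket a) = diag_op m"
    by (rule moment_map_hbracket) (use r m in \<open>simp_all add: s\<close>)
  \<comment> \<open>The entries are \<open>w (p i) + \<gamma> i\<close>,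
    \<open>w (q i) + \<gamma> i\<close> and \<open>w z - r\<close>, all positive by the choice of
    \<gamma>.\<close>
  have pos: "w b - r * m b > 0" if "b \<in> Basis" for b
    using that by (cases rule: Basis_cases) (use \<gamma> r in \<open>auto simp: m a r_def[symmetric]\<close>)
  have "diag_op (\<lambda>b. w b - r * m b) \<in> Diag_pos"
    unfolding Diag_pos_def using pos diag_op_Basis linear_diag_op by blast
  moreover have "diag_op m \<in> Diag" unfolding Diag_def using diag_op_Basis linear_diag_op by blast
  moreover have "diag_op w = (\<lambda>x. r *\<^sub>R diag_op m x + diag_op (\<lambda>b. w b - r * m b) x)"
    by (rule ext, rule euclidean_eqI) (simp add: diag_op_inner_Basis inner_add_left algebra_simps)
  moreover have "diag_op w \<in> heisenberg_torus n e" using w by (simp add: diag_op_mem_torus)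
  moreover have "tr (diag_op w) > 0" using r \<gamma>(4) by (simp add: tr_graded[OF w] r_def)
  ultimately show ?thesis
    unfolding cone_C_def using r orbit unfolding mm[symmetric] by blast
qed

end

theorem theorem1p4:
  fixes n :: nat and e :: "nat \<Rightarrow> 'a::euclidean_space"
  assumes "n \<ge> 1" and "bij_betw e {1..2*n+1} Basis"
  shows "cone_C (heisenberg n e) (heisenberg_torus n e)
           = srn (heisenberg n e) (heisenberg_torus n e)"
proof -
  interpret heisenberg_basis n e by unfold_locales fact+
  have "D \<in> cone_C (heisenberg n e) (heisenberg_torus n e) \<longleftrightarrow>
      strongly_ricci_negative (heisenberg n e) D" if D: "D \<in> heisenberg_torus n e" for D
  proof -
    obtain w where w: "D = diag_op w" "graded w" using torus_cases[OF D] by blast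
    show ?thesis
      unfolding w(1) using w(2) cone_imp_admissible admissible_imp_cone
        srn_imp_admissible admissible_imp_srn by metis
  qed
  moreover have "cone_C (heisenberg n e) (heisenberg_torus n e) \<subseteq> heisenberg_torus n e"
    by (auto simp: cone_C_def)
  ultimately show ?thesis by (auto simp: srn_def)
qed

end
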